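(* Let $K$, $\mathcal{E}$, $\mu$, the finite set $E\subset K$, $\Delta_\mu$, $\delta_0(E)$, $\delta_1(E)$ be as in the context, let $\{w(x)\}_{x\in E}$ be positive weights with $\sum_{x\in E}w(x)=1$, and let $\delta(E,w)$ be as in the context. (a) If $u\in\operatorname{dom}\mathcal{E}$, then $$\left|\int_K u\,d\mu-\sum_{x\in E}w(x)u(x)\right|\le\bigl(\delta_0(E)+\delta(E,w)\bigr)\mathcal{E}(u)^{1/2}.$$ (b) If $u\in\operatorname{dom}_{L^1}\Delta_\mu$, then $$\left|\int_K u\,d\mu-\sum_{x\in E}w(x)u(x)\right|\le\delta_1(E)\int_K|\Delta_\mu u|\,d\mu+\delta(E,w)\,\mathcal{E}(u)^{1/2}.$$
   Context: $K$ is a p.c.f. (post-critically finite) self-similar fractal in the sense of Kigami, generated by a finite family $\{F_i\}$ of contractive similarities of a Euclidean space: $K=\bigcup_i F_iK$, and there is a finite boundary set $V_0\subset K$ with $F_iK\cap F_jK\subseteq F_iV_0\cap F_jV_0$ for $i\ne j$. $K$ carries a regular harmonic structure, i.e. a self-similar energy (local regular Dirichlet form) $\mathcal{E}(u,v)$ with domain $\operatorname{dom}\mathcal{E}=\{u:\mathcal{E}(u)<\infty\}\subset C(K)$, where $\mathcal{E}(u)=\mathcal{E}(u,u)=\sum_i r_i^{-1}\mathcal{E}(u\circ F_i)$ with constants $0<r_i<1$. $\mu$ is a non-atomic Borel probability measure on $K$ that is positive on nonempty open sets. $E\subset K$ is a finite nonempty set. Laplacian: for $u\in\operatorname{dom}\mathcal{E}$,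 $\Delta_\mu u$ is defined by the weak formulation $\int_K v\,\Delta_\mu u\,d\mu=-\mathcal{E}(u,v)$ for all $v\in\operatorname{dom}\mathcal{E}$ (if $V_0\subseteq E$, it may be required only for those $v$ vanishing on $V_0$). $\operatorname{dom}_{L^1}\Delta_\mu$ is the space of $u$ for which $\Delta_\mu u$ exists in $L^1(d\mu)$. Green's function: $G_E(x,y)$ is the (symmetric, $\mu$-independent) Green's function with Dirichlet conditions on $E$: for suitable $f$, $F(x)=\int_K G_E(x,y)f(y)\,d\mu(y)$ is the unique solution of $-\Delta_\mu F=f$, $F|_E=0$, i.e. the unique $F\in\operatorname{dom}\mathcal{E}$ with $F|_E=0$ and $\mathcal{E}(F,v)=\int_K fv\,d\mu$ for all $v\in\operatorname{dom}\mathcal{E}$ vanishing on $E$. Put $g_E(x)=\int_K G_E(x,y)\,d\mu(y)$, $\delta_0(E)=\left(\int_K g_E\,d\mu\right)^{1/2}$ and $\delta_1(E)=\sup_{x\in K}g_E(x)$. Natural weights: $\mathcal{H}_E$ is the $\#E$-dimensional space of piecewise harmonic splines with nodes in $E$: continuous $v$ with $\Delta_\mu v=0$ on $K\setminus E$ (with vanishing normal derivative at points of $V_0\setminus E$); equivalently, $v\in\operatorname{dom}\mathcal{E}$ with $\mathcal{E}(v,\varphi)=0$ for all $\varphi\in\operatorname{dom}\mathcal{E}$ with $\varphi|_E=0$. Each $v\in\mathcal{H}_E$ is determined by its values on $E$. For $x\in E$, let $v_x\in\mathcal{H}_E$ satisfy $v_x(x)=1$ and $v_x=0$ on $E\setminus\{x\}$,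 and put $p(x)=\int_K v_x\,d\mu$. $R$ denotes the radius of $K$ in the effective resistance metric: the minimum value for which there exists $x_0\in K$ such that $|u(x)-u(x_0)|^2\le R\,\mathcal{E}(u)$ for all $x\in K$ and all $u\in\operatorname{dom}\mathcal{E}$. Finally $\delta(E,w)=R^{1/2}\sum_{x\in E}|p(x)-w(x)|$. *)

theory Defs
  imports "HOL-Analysis.Analysis" "HOL-Probability.Probability"
begin

text \<open>
  Functions on the fractal \<open>K\<close> are represented by total functions \<open>'a \<Rightarrow> real\<close>.  All
  notions below depend only on the values on \<open>K\<close>, so objects that are unique as functions
  on \<open>K\<close> are selected by \<open>SOME\<close> rather than \<open>THE\<close>.
\<close>

record ('i, 'a) fractal =
  maps :: "'i \<Rightarrow> 'a \<Rightarrow> 'a"             \<comment> \<open>\<open>F\<^sub>i\<close>\<close>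
  attractor :: "'a set"                  \<comment> \<open>\<open>K\<close>\<close>
  bdry :: "'a set"                       \<comment> \<open>\<open>V\<^sub>0\<close>\<close>
  conductance :: "'a \<Rightarrow> 'a \<Rightarrow> real"     \<comment> \<open>the graph energy on \<open>V\<^sub>0\<close>\<close>
  renorm :: "'i \<Rightarrow> real"                \<comment> \<open>\<open>r\<^sub>i\<close>\<close>

definition contractive_similarity :: "('a::metric_space \<Rightarrow> 'a) \<Rightarrow> bool" where
  "contractive_similarity f \<longleftrightarrow>
     (\<exists>\<rho>. 0 < \<rho> \<and> \<rho> < 1 \<and> (\<forall>x y. dist (f x) (f y) = \<rho> * dist x y))"

text \<open>\<open>F\<^sub>w = F\<^bsub>w1\<^esub> \<circ> \<dots> \<circ> F\<^bsub>wm\<^esub>\<close> and \<open>r\<^sub>w = r\<^bsub>w1\<^esub> \<cdots> r\<^bsub>wm\<^esub>\<close>.\<close>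

definition word_map :: "('i, 'a) fractal \<Rightarrow> 'i list \<Rightarrow> 'a \<Rightarrow> 'a" where
  "word_map S w = foldr (\<lambda>i g. maps S i \<circ> g) w id"

definition word_renorm :: "('i, 'a) fractal \<Rightarrow> 'i list \<Rightarrow> real" where
  "word_renorm S w = prod_list (map (renorm S) w)"

text \<open>Kigami's coding map from the shift space to \<open>K\<close>, and the critical and post-critical sets.\<close>

definition coding_map :: "('i, 'a) fractal \<Rightarrow> (nat \<Rightarrow> 'i) \<Rightarrow> 'a" where
  "coding_map S \<omega> = (THE x. \<forall>n. x \<in> word_map S (map \<omega> [0..<n]) ` attractor S)"

definition critical_set :: "('i, 'a) fractal \<Rightarrow> (nat \<Rightarrow> 'i) set" where
  "critical_set S = {\<omega>. \<exists>i j. i \<noteq> j \<and>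
     coding_map S \<omega> \<in> maps S i ` attractor S \<inter> maps S j ` attractor S}"

definition post_critical_set :: "('i, 'a) fractal \<Rightarrow> (nat \<Rightarrow> 'i) set" where
  "post_critical_set S = {(\<lambda>k. \<omega> (k + n)) | \<omega> n. \<omega> \<in> critical_set S \<and> 1 \<le> n}"

text \<open>
  Kigami's choice of the boundary is the image of the post-critical set under the coding map;
  it satisfies \<open>bdry_finite\<close>, \<open>bdry_subset\<close>, \<open>bdry_cells\<close> and \<open>cells_inter\<close>.  Other boundary
  sets with these properties are admitted too.  Condition \<open>bdry_cells\<close> is
  \<open>V\<^sub>0 \<subseteq> V\<^sub>1\<close>, without which the trace of the level-1 energy on \<open>V\<^sub>0\<close> makes no sense.
\<close>

locale pcf_fractal =
  fixes S :: "('i::finite, 'a::euclidean_space) fractal"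
  assumes similarity: "contractive_similarity (maps S i)"
    and attractor_compact: "compact (attractor S)"
    and attractor_nonempty: "attractor S \<noteq> {}"
    and attractor_connected: "connected (attractor S)"
    and self_similar: "attractor S = (\<Union>i. maps S i ` attractor S)"
    and post_critically_finite: "finite (post_critical_set S)"
    and bdry_finite: "finite (bdry S)"
    and bdry_subset: "bdry S \<subseteq> attractor S"
    and bdry_cells: "bdry S \<subseteq> (\<Union>i. maps S i ` bdry S)"
    and cells_inter: "i \<noteq> j \<Longrightarrow>
      maps S i ` attractor S \<inter> maps S j ` attractor S \<subseteq> maps S i ` bdry S \<inter> maps S j ` bdry S"

text \<open>The factor 1/2 compensates for counting every edge in both directions.\<close>

definition bdry_energy :: "('i, 'a) fractal \<Rightarrow> ('a \<Rightarrow> real) \<Rightarrow> ('a \<Rightarrow> real) \<Rightarrow> real" where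
  "bdry_energy S u v =
     (1/2) * (\<Sum>p\<in>bdry S. \<Sum>q\<in>bdry S. conductance S p q * (u p - u q) * (v p - v q))"

definition level_energy ::
    "('i::finite, 'a) fractal \<Rightarrow> nat \<Rightarrow> ('a \<Rightarrow> real) \<Rightarrow> ('a \<Rightarrow> real) \<Rightarrow> real" where
  "level_energy S m u v =
     (\<Sum>w | length w = m.
        inverse (word_renorm S w) * bdry_energy S (u \<circ> word_map S w) (v \<circ> word_map S w))"

text \<open>
  A regular harmonic structure in the sense of Kigami: an irreducible graph Laplacian on
  \<open>V\<^sub>0\<close> and factors \<open>0 < r\<^sub>i < 1\<close> such that the minimum of the level-1 energy among all
  extensions of \<open>u\<close> from \<open>V\<^sub>0\<close> is the level-0 energy of \<open>u\<close>.
\<close>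

locale regular_harmonic_structure = pcf_fractal S
  for S :: "('i::finite, 'a::euclidean_space) fractal" +
  assumes conductance_sym:
      "\<lbrakk>p \<in> bdry S; q \<in> bdry S\<rbrakk> \<Longrightarrow> conductance S p q = conductance S q p"
    and conductance_nonneg:
      "\<lbrakk>p \<in> bdry S; q \<in> bdry S\<rbrakk> \<Longrightarrow> 0 \<le> conductance S p q"
    and irreducible:
      "\<lbrakk>bdry_energy S u u = 0; p \<in> bdry S; q \<in> bdry S\<rbrakk> \<Longrightarrow> u p = u q"
    and renorm_pos: "0 < renorm S i"
    and regular: "renorm S i < 1"
    and trace_le:
      "(\<forall>p\<in>bdry S. v p = u p) \<Longrightarrow> level_energy S 0 u u \<le> level_energy S 1 v v"
    and trace_attained:
      "\<exists>v. (\<forall>p\<in>bdry S. v p = u p) \<and> level_energy S 1 v v = level_energy S 0 u u"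

text \<open>
  For a harmonic structure \<open>level_energy S m u u\<close> is nondecreasing in \<open>m\<close>, so convergence
  means that the limiting energy is finite.
\<close>

definition dom_energy :: "('i::finite, 'a::topological_space) fractal \<Rightarrow> ('a \<Rightarrow> real) set" where
  "dom_energy S =
     {u. continuous_on (attractor S) u \<and> convergent (\<lambda>m. level_energy S m u u)}"

definition energy :: "('i::finite, 'a) fractal \<Rightarrow> ('a \<Rightarrow> real) \<Rightarrow> ('a \<Rightarrow> real) \<Rightarrow> real" where
  "energy S u v = lim (\<lambda>m. level_energy S m u v)"

definition non_atomic :: "'a measure \<Rightarrow> bool" where
  "non_atomic M \<longleftrightarrow> (\<forall>A\<in>sets M. 0 < emeasure M A \<longrightarrow>
     (\<exists>B\<in>sets M. B \<subseteq> A \<and> 0 < emeasure M B \<and> emeasure M B < emeasure M A))"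

text \<open>Nonempty open sets are understood relative to \<open>K\<close>.\<close>

locale fractal_measure = prob_space M
  for S :: "('i, 'a::euclidean_space) fractal" and M :: "'a measure" +
  assumes sets_M: "sets M = sets (restrict_space borel (attractor S))"
    and non_atomic: "non_atomic M"
    and open_pos: "\<lbrakk>open U; U \<inter> attractor S \<noteq> {}\<rbrakk> \<Longrightarrow> 0 < emeasure M (U \<inter> attractor S)"

text \<open>
  The weak Laplacian, tested against the \<open>v \<in> dom \<E>\<close> that vanish on \<open>B\<close>.  The
  cases of interest are \<open>B = {}\<close> (all test functions) and \<open>B = V\<^sub>0\<close>.
\<close>

definition is_laplacian ::
    "('i::finite, 'a::topological_space) fractal \<Rightarrow> 'a measure \<Rightarrow> 'a set
      \<Rightarrow> ('a \<Rightarrow> real) \<Rightarrow> ('a \<Rightarrow> real) \<Rightarrow> bool" where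
  "is_laplacian S M B u f \<longleftrightarrow>
     (\<forall>v\<in>dom_energy S. (\<forall>x\<in>B. v x = 0) \<longrightarrow> (\<integral>x. v x * f x \<partial>M) = - energy S u v)"

definition dom_laplacian_L1 ::
    "('i::finite, 'a::topological_space) fractal \<Rightarrow> 'a measure \<Rightarrow> 'a set \<Rightarrow> ('a \<Rightarrow> real) set" where
  "dom_laplacian_L1 S M B = {u \<in> dom_energy S. \<exists>f. integrable M f \<and> is_laplacian S M B u f}"

definition laplacian ::
    "('i::finite, 'a::topological_space) fractal \<Rightarrow> 'a measure \<Rightarrow> 'a set
      \<Rightarrow> ('a \<Rightarrow> real) \<Rightarrow> 'a \<Rightarrow> real" where
  "laplacian S M B u = (SOME f. integrable M f \<and> is_laplacian S M B u f)"

definition dirichlet_solution ::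
    "('i::finite, 'a::topological_space) fractal \<Rightarrow> 'a measure \<Rightarrow> 'a set
      \<Rightarrow> ('a \<Rightarrow> real) \<Rightarrow> ('a \<Rightarrow> real) \<Rightarrow> bool" where
  "dirichlet_solution S M E f h \<longleftrightarrow>
     h \<in> dom_energy S \<and> (\<forall>x\<in>E. h x = 0) \<and>
     (\<forall>v\<in>dom_energy S. (\<forall>x\<in>E. v x = 0) \<longrightarrow> energy S h v = (\<integral>x. f x * v x \<partial>M))"

text \<open>
  The equivalence in the last conjunct says that integration against \<open>G\<close> gives a solution
  of the Dirichlet problem with right-hand side \<open>f\<close> and that this solution is unique on \<open>K\<close>.
\<close>

definition is_greens_function ::
    "('i::finite, 'a::topological_space) fractal \<Rightarrow> 'a measure \<Rightarrow> 'a set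
      \<Rightarrow> ('a \<Rightarrow> 'a \<Rightarrow> real) \<Rightarrow> bool" where
  "is_greens_function S M E G \<longleftrightarrow>
     continuous_on (attractor S \<times> attractor S) (\<lambda>(x, y). G x y) \<and>
     (\<forall>x\<in>attractor S. \<forall>y\<in>attractor S. G x y = G y x) \<and>
     (\<forall>f h. integrable M f \<longrightarrow>
        (dirichlet_solution S M E f h \<longleftrightarrow> (\<forall>x\<in>attractor S. h x = (\<integral>y. G x y * f y \<partial>M))))"

definition greens_function ::
    "('i::finite, 'a::topological_space) fractal \<Rightarrow> 'a measure \<Rightarrow> 'a set \<Rightarrow> 'a \<Rightarrow> 'a \<Rightarrow> real" where
  "greens_function S M E = (SOME G. is_greens_function S M E G)"

definition green_integral ::
    "('i::finite, 'a::topological_space) fractal \<Rightarrow> 'a measure \<Rightarrow> 'a set \<Rightarrow> 'a \<Rightarrow> real" where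
  "green_integral S M E x = (\<integral>y. greens_function S M E x y \<partial>M)"

definition delta0 ::
    "('i::finite, 'a::topological_space) fractal \<Rightarrow> 'a measure \<Rightarrow> 'a set \<Rightarrow> real" where
  "delta0 S M E = sqrt (\<integral>x. green_integral S M E x \<partial>M)"

definition delta1 ::
    "('i::finite, 'a::topological_space) fractal \<Rightarrow> 'a measure \<Rightarrow> 'a set \<Rightarrow> real" where
  "delta1 S M E = (SUP x\<in>attractor S. green_integral S M E x)"

definition harmonic_splines ::
    "('i::finite, 'a::topological_space) fractal \<Rightarrow> 'a set \<Rightarrow> ('a \<Rightarrow> real) set" where
  "harmonic_splines S E =
     {v \<in> dom_energy S. \<forall>\<phi>\<in>dom_energy S. (\<forall>x\<in>E. \<phi> x = 0) \<longrightarrow> energy S v \<phi> = 0}"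

definition spline_basis ::
    "('i::finite, 'a::topological_space) fractal \<Rightarrow> 'a set \<Rightarrow> 'a \<Rightarrow> 'a \<Rightarrow> real" where
  "spline_basis S E x =
     (SOME v. v \<in> harmonic_splines S E \<and> v x = 1 \<and> (\<forall>y\<in>E - {x}. v y = 0))"

definition natural_weight ::
    "('i::finite, 'a::topological_space) fractal \<Rightarrow> 'a measure \<Rightarrow> 'a set \<Rightarrow> 'a \<Rightarrow> real" where
  "natural_weight S M E x = (\<integral>y. spline_basis S E x y \<partial>M)"

definition resistance_radius :: "('i::finite, 'a::topological_space) fractal \<Rightarrow> real" where
  "resistance_radius S =
     (LEAST R. \<exists>x0\<in>attractor S. \<forall>x\<in>attractor S. \<forall>u\<in>dom_energy S.
        \<bar>u x - u x0\<bar>\<^sup>2 \<le> R * energy S u u)"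

definition weight_defect ::
    "('i::finite, 'a::topological_space) fractal \<Rightarrow> 'a measure \<Rightarrow> 'a set
      \<Rightarrow> ('a \<Rightarrow> real) \<Rightarrow> real" where
  "weight_defect S M E w =
     sqrt (resistance_radius S) * (\<Sum>x\<in>E. \<bar>natural_weight S M E x - w x\<bar>)"

end

theory Submission
  imports Defs
begin

text \<open>
  Let \<open>s\<close> be the piecewise harmonic spline with nodes \<open>E\<close> that interpolates \<open>u\<close>, and
  \<open>g = g\<^sub>E\<close>.  Since \<open>s = \<Sum>\<^sub>x u(x) v\<^sub>x\<close>, the natural weights \<open>p\<close> integrate \<open>s\<close> exactly, so that
  \<open>\<integral>u - \<Sum>\<^sub>x w(x) u(x) = \<integral>(u - s) + \<Sum>\<^sub>x (p(x) - w(x)) u(x)\<close>.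
  The weights \<open>p\<close> and \<open>w\<close> both have sum one (the \<open>v\<^sub>x\<close> add up to the spline \<open>1\<close>), hence \<open>u(x)\<close> may be
  replaced by \<open>u(x) - u(x\<^sub>0)\<close> in the last sum, where \<open>x\<^sub>0\<close> is a center for the resistance radius;
  this yields the term \<open>\<delta>(E, w) \<E>(u)\<^sup>1\<^sup>/\<^sup>2\<close> (lemma \<open>weight_change\<close>).

  The function \<open>g\<close> represents integration: \<open>\<E>(g, v) = \<integral>v\<close> for \<open>v\<close> vanishing on \<open>E\<close>, in particular
  for \<open>v = u - s\<close>.  Moreover \<open>\<E>(g, g) = \<integral>g = \<delta>\<^sub>0\<^sup>2\<close>, and \<open>\<E>(u - s) \<le> \<E>(u)\<close> because interpolation is an
  orthogonal projection, so (a) is the Cauchy-Schwarz inequality.  For (b), \<open>\<E>(g, s) = 0\<close> gives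
  \<open>\<integral>(u - s) = \<E>(g, u) = - \<integral>g \<Delta>u\<close>, and \<open>0 \<le> g \<le> \<delta>\<^sub>1\<close>;
  the lower bound holds because \<open>\<bar>g\<bar>\<close> solves the same minimisation problem as \<open>g\<close>.

  Most of the work is to show that these objects exist.  All of it rests on two facts about the
  energy.  The first is the estimate \<open>\<bar>u(x) - u(y)\<bar> \<le> C \<E>(u)\<^sup>1\<^sup>/\<^sup>2\<close> together with the equicontinuity of
  functions of bounded energy (\<open>verts_resistance\<close>, \<open>verts_equicontinuous\<close>).  It makes the
  functions of finite energy vanishing on \<open>E\<close> a Hilbert space with continuous point evaluations, and
  the Riesz representation theorem (\<open>energy_riesz\<close>) then produces the Green's function as
  reproducing kernel, the solutions of the Dirichlet problem, and the splines.  The second fact is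
  that functions of finite energy separate points (\<open>dom_energy_separates\<close>); it is obtained by harmonic
  extension and provides the basis \<open>v\<^sub>x\<close>.
\<close>

section \<open>Words, cells and vertices\<close>

lemma word_map_Nil [simp]: "word_map S [] = id"
  by (simp add: word_map_def)

lemma word_map_Cons [simp]: "word_map S (i # w) = maps S i \<circ> word_map S w"
  by (simp add: word_map_def)

lemma word_renorm_Nil [simp]: "word_renorm S [] = 1"
  by (simp add: word_renorm_def)

lemma word_renorm_Cons [simp]: "word_renorm S (i # w) = renorm S i * word_renorm S w"
  by (simp add: word_renorm_def)

lemma finite_words [simp]: "finite {w :: 'i::finite list. length w = m}"
  using finite_lists_length_eq[of "UNIV :: 'i set" m] by simp

lemma words_Suc:
  "{w :: 'i list. length w = Suc m} = (\<lambda>(i, w). i # w) ` (UNIV \<times> {w. length w = m})"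
  by (auto simp: length_Suc_conv image_iff)

lemma UN_words_Suc:
  fixes f :: "'i list \<Rightarrow> 'b set"
  shows "(\<Union>w\<in>{w. length w = Suc m}. f w) = (\<Union>i. \<Union>w\<in>{w. length w = m}. f (i # w))"
  by (auto simp: words_Suc)

lemma sum_words_Suc:
  fixes f :: "'i::finite list \<Rightarrow> 'b::comm_monoid_add"
  shows "(\<Sum>w | length w = Suc m. f w) = (\<Sum>i\<in>UNIV. \<Sum>w | length w = m. f (i # w))"
proof -
  have "(\<Sum>w | length w = Suc m. f w) = (\<Sum>x\<in>UNIV \<times> {w. length w = m}. f (fst x # snd x))"
    unfolding words_Suc
    by (subst sum.reindex) (auto simp: inj_on_def case_prod_unfold intro!: sum.cong)
  also have "\<dots> = (\<Sum>i\<in>UNIV. \<Sum>w | length w = m. f (i # w))"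
    by (simp add: sum.cartesian_product case_prod_unfold)
  finally show ?thesis .
qed

context pcf_fractal
begin

text \<open>The vertex sets \<open>V\<^sub>m\<close>.  The recursion adds the outermost map, as does the self-similarity of the
  level energies.\<close>

primrec verts :: "nat \<Rightarrow> 'a set" where
  "verts 0 = bdry S"
| "verts (Suc m) = (\<Union>i. maps S i ` verts m)"

definition all_verts :: "'a set" where
  "all_verts = (\<Union>m. verts m)"

lemma inj_maps: "inj (maps S i)"
proof -
  obtain \<rho> where "0 < \<rho>" "\<And>x y. dist (maps S i x) (maps S i y) = \<rho> * dist x y"
    using similarity[of i] unfolding contractive_similarity_def by auto
  then show ?thesis
    by (metis dist_eq_0_iff injI mult_eq_0_iff order_less_irrefl)
qed

lemma maps_eq_iff [simp]: "maps S i x = maps S i y \<longleftrightarrow> x = y"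
  using inj_maps by (auto dest: injD)

lemma continuous_maps: "continuous_on X (maps S i)"
proof -
  obtain \<rho> where r: "0 < \<rho>" "\<rho> < 1" "\<And>x y. dist (maps S i x) (maps S i y) = \<rho> * dist x y"
    using similarity[of i] unfolding contractive_similarity_def by auto
  have "\<rho> * dist x y \<le> dist x y" for x y
    using r by (simp add: mult_left_le_one_le)
  then show ?thesis
    unfolding continuous_on_iff using r(3) by (metis order_le_less_trans)
qed

lemma maps_in_attractor [simp]: "x \<in> attractor S \<Longrightarrow> maps S i x \<in> attractor S"
  using self_similar by blast

lemma word_map_in_attractor [simp]: "x \<in> attractor S \<Longrightarrow> word_map S w x \<in> attractor S"
  by (induction w) auto

lemma in_attractorE:
  assumes "x \<in> attractor S"
  obtains i y where "y \<in> attractor S" "x = maps S i y"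
proof -
  have "x \<in> (\<Union>i. maps S i ` attractor S)" using assms self_similar by metis
  then show ?thesis using that by blast
qed

lemma continuous_word_map: "continuous_on X (word_map S w)"
proof (induction w arbitrary: X)
  case (Cons i w)
  show ?case
    unfolding word_map_Cons by (rule continuous_on_compose[OF Cons continuous_maps])
qed (simp add: id_def)

lemma in_word_cell: "x \<in> attractor S \<Longrightarrow> \<exists>w. length w = m \<and> x \<in> word_map S w ` attractor S"
proof (induction m arbitrary: x)
  case (Suc m)
  obtain i y where y: "y \<in> attractor S" "x = maps S i y"
    using Suc.prems by (rule in_attractorE)
  obtain w where "length w = m" "y \<in> word_map S w ` attractor S"
    using Suc.IH[OF y(1)] by auto
  then show ?case using y by (intro exI[of _ "i # w"]) auto
qed (auto intro!: exI[of _ "[]"])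

lemma verts_eq_words: "verts m = (\<Union>w\<in>{w. length w = m}. word_map S w ` bdry S)"
proof (induction m)
  case (Suc m)
  have "verts (Suc m) = (\<Union>i. \<Union>w\<in>{w. length w = m}. word_map S (i # w) ` bdry S)"
    by (simp add: Suc.IH image_UN image_comp)
  also have "\<dots> = (\<Union>w\<in>{w. length w = Suc m}. word_map S w ` bdry S)"
    by (simp only: UN_words_Suc)
  finally show ?case .
qed simp

lemma in_verts_iff: "x \<in> verts m \<longleftrightarrow> (\<exists>w. length w = m \<and> x \<in> word_map S w ` bdry S)"
  by (auto simp: verts_eq_words)

lemma word_map_verts: "x \<in> verts m \<Longrightarrow> word_map S w x \<in> verts (length w + m)"
  by (induction w) auto

lemma verts_subset_attractor: "verts m \<subseteq> attractor S"
  using bdry_subset by (induction m) auto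

lemma verts_Suc_mono: "verts m \<subseteq> verts (Suc m)"
proof (induction m)
  case 0 then show ?case using bdry_cells by simp
next
  case (Suc m)
  have "verts (Suc m) = (\<Union>i. maps S i ` verts m)" by simp
  also have "\<dots> \<subseteq> (\<Union>i. maps S i ` verts (Suc m))" using Suc by blast
  finally show ?case by simp
qed

lemma verts_mono: "m \<le> n \<Longrightarrow> verts m \<subseteq> verts n"
  by (rule lift_Suc_mono_le[of verts]) (use verts_Suc_mono in auto)

lemma verts_add_cases:
  "z \<in> verts (n + m) \<Longrightarrow> \<exists>w a. length w = n \<and> a \<in> verts m \<and> z = word_map S w a"
proof (induction n arbitrary: z)
  case (Suc n)
  then obtain i y where y: "y \<in> verts (n + m)" "z = maps S i y" by auto
  then obtain w a where "length w = n" "a \<in> verts m" "y = word_map S w a" using Suc.IH by blast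
  then show ?case using y by (intro exI[of _ "i # w"] exI[of _ a]) simp
qed simp

lemma bdry_in_verts: "x \<in> bdry S \<Longrightarrow> x \<in> verts m"
  using verts_mono[of 0 m] by auto

lemma all_verts_subset: "all_verts \<subseteq> attractor S"
  using verts_subset_attractor by (auto simp: all_verts_def)

text \<open>The finite ramification of first-level cells propagates to cells of every level, because a
  boundary point that lies in a cell is a vertex of that cell.\<close>

lemma word_cells_inter:
  assumes "length w = length w'" "w \<noteq> w'" "x \<in> word_map S w ` attractor S"
    "x \<in> word_map S w' ` attractor S"
  shows "x \<in> word_map S w ` bdry S"
  using assms
proof (induction w arbitrary: w' x)
  case (Cons i t)
  then obtain j t' where w': "w' = j # t'" by (cases w') auto
  obtain y y' where y: "y \<in> attractor S" "x = maps S i (word_map S t y)"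
    and y': "y' \<in> attractor S" "x = maps S j (word_map S t' y')"
    using Cons.prems w' by auto
  show ?case
  proof (cases "i = j")
    case True
    then have eq: "word_map S t y = word_map S t' y'" using y y' by simp
    have "word_map S t y \<in> word_map S t ` bdry S"
      by (rule Cons.IH[of t']) (use Cons.prems w' True y y' eq in auto)
    then show ?thesis using y by auto
  next
    case False
    have "x \<in> maps S i ` attractor S" "x \<in> maps S j ` attractor S"
      using y y' word_map_in_attractor by blast+
    then have "x \<in> maps S i ` bdry S"
      using cells_inter[OF False] by blast
    then have b: "word_map S t y \<in> bdry S" using y by auto
    \<comment> \<open>\<open>V\<^sub>0 \<subseteq> V\<^sub>m\<close> puts this boundary point into a cell of the length of \<open>t\<close>.\<close>
    then obtain s where s: "length s = length t" "word_map S t y \<in> word_map S s ` bdry S"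
      using in_verts_iff bdry_in_verts by blast
    have "word_map S t y \<in> word_map S t ` bdry S"
    proof (cases "s = t")
      case False
      show ?thesis
        by (rule Cons.IH[of s]) (use s False y bdry_subset in auto)
    qed (use s in auto)
    then show ?thesis using y by auto
  qed
qed auto

lemma uniform_contraction:
  obtains \<rho> where "0 < \<rho>" "\<rho> < 1"
    "\<And>w x y. dist (word_map S w x) (word_map S w y) \<le> \<rho> ^ length w * dist x y"
proof -
  have "\<forall>i. \<exists>r. 0 < r \<and> r < 1 \<and> (\<forall>x y. dist (maps S i x) (maps S i y) = r * dist x y)"
    using similarity unfolding contractive_similarity_def by blast
  then obtain r where r: "\<And>i. 0 < r i" "\<And>i. r i < 1"
    "\<And>i x y. dist (maps S i x) (maps S i y) = r i * dist x y"
    by metis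
  define \<rho> where "\<rho> = Max (range r)"
  have le: "r i \<le> \<rho>" for i by (simp add: \<rho>_def)
  have "\<rho> \<in> range r" unfolding \<rho>_def by (rule Max_in) auto
  then have \<rho>: "0 < \<rho>" "\<rho> < 1" using r by auto
  have "dist (word_map S w x) (word_map S w y) \<le> \<rho> ^ length w * dist x y" for w x y
  proof (induction w)
    case (Cons i w)
    have "r i * dist (word_map S w x) (word_map S w y) \<le> \<rho> * (\<rho> ^ length w * dist x y)"
      by (rule mult_mono) (use le \<rho> Cons in auto)
    then show ?case using r(3) by (simp add: mult.assoc)
  qed auto
  then show ?thesis using that \<rho> by blast
qed

lemma cells_small:
  assumes "0 < e"
  shows "\<exists>m. \<forall>w. length w = m \<longrightarrow>
    (\<forall>x\<in>word_map S w ` attractor S. \<forall>y\<in>word_map S w ` attractor S. dist x y < e)"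
proof -
  obtain \<rho> where \<rho>: "0 < \<rho>" "\<rho> < 1"
    "\<And>w x y. dist (word_map S w x) (word_map S w y) \<le> \<rho> ^ length w * dist x y"
    using uniform_contraction by blast
  define D where "D = diameter (attractor S) + 1"
  have D: "dist x y \<le> D" if "x \<in> attractor S" "y \<in> attractor S" for x y
    using diameter_bounded_bound[OF compact_imp_bounded[OF attractor_compact] that]
    by (simp add: D_def)
  have Dpos: "0 < D"
    using diameter_ge_0[OF compact_imp_bounded[OF attractor_compact]] by (simp add: D_def)
  obtain m where m: "\<rho> ^ m < e / D"
    using real_arch_pow_inv[of "e / D" \<rho>] \<rho> assms Dpos by auto
  have "dist (word_map S w x) (word_map S w y) < e"
    if "length w = m" "x \<in> attractor S" "y \<in> attractor S" for w x y
  proof -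
    have "dist (word_map S w x) (word_map S w y) \<le> \<rho> ^ m * dist x y" using \<rho>(3)[of w x y] that by simp
    also have "\<dots> \<le> \<rho> ^ m * D" using D that \<rho> by (simp add: mult_left_mono)
    also have "\<dots> < e" using m Dpos by (simp add: pos_less_divide_eq)
    finally show ?thesis .
  qed
  then show ?thesis by blast
qed

text \<open>Connectedness of the attractor makes the graph of cells connected: a set of first-level
  cells that contains every cell touching one of its members splits the attractor into two
  disjoint closed pieces.\<close>

lemma cell_graph_connected:
  assumes "i \<in> A"
    and closed_under: "\<And>j k. j \<in> A \<Longrightarrow> maps S j ` attractor S \<inter> maps S k ` attractor S \<noteq> {} \<Longrightarrow> k \<in> A"
  shows "j \<in> A"
proof (rule ccontr)
  assume j: "j \<notin> A"
  let ?X = "\<Union>j\<in>A. maps S j ` attractor S" and ?Y = "\<Union>j\<in>-A. maps S j ` attractor S"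
  have cl: "closed (maps S j ` attractor S)" for j
    by (intro compact_imp_closed compact_continuous_image continuous_maps attractor_compact)
  have "closed ?X" "closed ?Y" by (intro closed_UN; simp add: cl)+
  moreover have "attractor S \<subseteq> ?X \<union> ?Y"
  proof
    fix x assume "x \<in> attractor S"
    then obtain i y where "y \<in> attractor S" "x = maps S i y" by (rule in_attractorE)
    then show "x \<in> ?X \<union> ?Y" by (cases "i \<in> A") auto
  qed
  moreover have "?X \<inter> ?Y \<inter> attractor S = {}"
    using closed_under by blast
  ultimately have "?X \<inter> attractor S = {} \<or> ?Y \<inter> attractor S = {}"
    using connected_closedD[OF attractor_connected, of ?X ?Y] by argo
  moreover obtain p where p: "p \<in> attractor S" using attractor_nonempty by auto
  have "maps S i p \<in> ?X \<inter> attractor S" "maps S j p \<in> ?Y \<inter> attractor S"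
    using p assms(1) j by auto
  ultimately show False by blast
qed

text \<open>Without boundary points distinct cells would be disjoint, so by connectedness there would be
  a single cell map, and its attractor is a point.\<close>

lemma bdry_nonempty:
  assumes "x \<in> attractor S" "y \<in> attractor S" "x \<noteq> y"
  shows "bdry S \<noteq> {}"
proof
  assume e: "bdry S = {}"
  fix i0 :: 'i
  \<comment> \<open>The singleton \<open>{i0}\<close> contains every cell that touches its member.\<close>
  have one: "j = i0" for j
    using cell_graph_connected[of i0 "{i0}" j] cells_inter e by auto
  obtain n where n: "\<forall>w. length w = n \<longrightarrow>
    (\<forall>a\<in>word_map S w ` attractor S. \<forall>b\<in>word_map S w ` attractor S. dist a b < dist x y)"
    using cells_small[of "dist x y"] assms by auto
  obtain w w' where w: "length w = n" "x \<in> word_map S w ` attractor S"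
    "length w' = n" "y \<in> word_map S w' ` attractor S"
    using in_word_cell[OF assms(1)] in_word_cell[OF assms(2)] by blast
  have "w = w'" by (rule nth_equalityI) (use w one in \<open>auto, metis\<close>)
  then show False using n w by blast
qed

lemma all_verts_dense:
  assumes "bdry S \<noteq> {}"
  shows "closure all_verts = attractor S"
proof
  show "closure all_verts \<subseteq> attractor S"
    by (intro closure_minimal all_verts_subset compact_imp_closed attractor_compact)
  obtain q where q: "q \<in> bdry S" using assms by auto
  show "attractor S \<subseteq> closure all_verts"
  proof
    fix x assume x: "x \<in> attractor S"
    show "x \<in> closure all_verts"
      unfolding closure_approachable
    proof (intro allI impI)
      fix e :: real assume "0 < e"
      then obtain m where m: "\<forall>w. length w = m \<longrightarrow>
        (\<forall>a\<in>word_map S w ` attractor S. \<forall>b\<in>word_map S w ` attractor S. dist a b < e)"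
        using cells_small by blast
      obtain w where w: "length w = m" "x \<in> word_map S w ` attractor S"
        using in_word_cell[OF x] by blast
      have "word_map S w q \<in> all_verts"
        unfolding all_verts_def using in_verts_iff q w by blast
      moreover have "dist (word_map S w q) x < e"
        using m w q bdry_subset by blast
      ultimately show "\<exists>y\<in>all_verts. dist y x < e" by blast
    qed
  qed
qed

text \<open>Finitely many compact cells of a given level: disjoint ones are a positive distance apart.\<close>

lemma close_points_touching_cells:
  obtains d where "0 < d"
    "\<And>w w' x y. \<lbrakk>length w = m; length w' = m; x \<in> word_map S w ` attractor S;
       y \<in> word_map S w' ` attractor S; dist x y < d\<rbrakk>
      \<Longrightarrow> word_map S w ` attractor S \<inter> word_map S w' ` attractor S \<noteq> {}"
proof -
  let ?C = "\<lambda>w. word_map S w ` attractor S"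
  have comp: "compact (?C w)" for w
    by (intro compact_continuous_image continuous_word_map attractor_compact)
  have "\<exists>d>0. ?C w \<inter> ?C w' = {} \<longrightarrow> (\<forall>x\<in>?C w. \<forall>y\<in>?C w'. d \<le> dist x y)" for w w'
  proof (cases "?C w \<inter> ?C w' = {}")
    case True
    then show ?thesis
      using separate_compact_closed[OF comp[of w] compact_imp_closed[OF comp[of w']]] by blast
  qed (auto intro: exI[of _ 1])
  then obtain d where d: "\<And>w w'. 0 < d w w'"
    "\<And>w w' x y. ?C w \<inter> ?C w' = {} \<Longrightarrow> x \<in> ?C w \<Longrightarrow> y \<in> ?C w' \<Longrightarrow> d w w' \<le> dist x y"
    by metis
  let ?W = "{w. length w = m} \<times> {w. length w = m}"
  define D where "D = Min (insert 1 ((\<lambda>(w, w'). d w w') ` ?W))"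
  have fin: "finite (insert 1 ((\<lambda>(w, w'). d w w') ` ?W))" by simp
  have "0 < D" unfolding D_def by (subst Min_gr_iff) (use fin d in auto)
  moreover have "D \<le> d w w'" if "length w = m" "length w' = m" for w w'
    unfolding D_def by (rule Min_le[OF fin]) (use that in force)
  ultimately show ?thesis
    using d(2) that[of D] by (meson order_le_less_trans less_irrefl order_trans)
qed

end

section \<open>Level energies\<close>

lemma bdry_energy_commute: "bdry_energy S u v = bdry_energy S v u"
  by (simp add: bdry_energy_def mult.commute mult.left_commute)

lemma bdry_energy_add: "bdry_energy S (\<lambda>x. u x + v x) z = bdry_energy S u z + bdry_energy S v z"
  by (simp add: bdry_energy_def algebra_simps flip: sum.distrib)

lemma bdry_energy_scale: "bdry_energy S (\<lambda>x. c * u x) z = c * bdry_energy S u z"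
  by (simp add: bdry_energy_def algebra_simps sum_distrib_left)

lemma level_energy_commute: "level_energy S m u v = level_energy S m v u"
  unfolding level_energy_def by (subst bdry_energy_commute) simp

lemma level_energy_add:
  "level_energy S m (\<lambda>x. u x + v x) z = level_energy S m u z + level_energy S m v z"
  by (simp add: level_energy_def o_def bdry_energy_add algebra_simps flip: sum.distrib)

lemma level_energy_scale: "level_energy S m (\<lambda>x. c * u x) z = c * level_energy S m u z"
  by (simp add: level_energy_def o_def bdry_energy_scale algebra_simps sum_distrib_left)

lemma level_energy_0: "level_energy S 0 u v = bdry_energy S u v"
  by (simp add: level_energy_def)

lemma level_energy_Suc:
  "level_energy S (Suc m) u v =
    (\<Sum>i\<in>UNIV. inverse (renorm S i) * level_energy S m (u \<circ> maps S i) (v \<circ> maps S i))"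
  by (simp add: level_energy_def sum_words_Suc sum_distrib_left mult.assoc comp_assoc)

lemma level_energy_expand:
  "level_energy S m (\<lambda>x. u x + t * v x) (\<lambda>x. u x + t * v x) =
     level_energy S m u u + 2 * t * level_energy S m u v + t\<^sup>2 * level_energy S m v v"
proof -
  have "level_energy S m z (\<lambda>x. u x + t * v x) = level_energy S m z u + t * level_energy S m z v" for z
    by (simp add: level_energy_commute[of S m z] level_energy_add level_energy_scale)
  then show ?thesis
    by (simp add: level_energy_add level_energy_scale level_energy_commute[of S m v u]
        power2_eq_square algebra_simps)
qed

context pcf_fractal
begin

lemma word_map_bdry: "x \<in> bdry S \<Longrightarrow> word_map S w x \<in> verts (length w)"
  using word_map_verts[of x 0 w] by simp

lemma level_energy_cong:
  "(\<And>x. x \<in> verts m \<Longrightarrow> u x = u' x) \<Longrightarrow> (\<And>x. x \<in> verts m \<Longrightarrow> v x = v' x)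
    \<Longrightarrow> level_energy S m u v = level_energy S m u' v'"
proof -
  assume *: "\<And>x. x \<in> verts m \<Longrightarrow> u x = u' x" "\<And>x. x \<in> verts m \<Longrightarrow> v x = v' x"
  show "level_energy S m u v = level_energy S m u' v'"
    unfolding level_energy_def bdry_energy_def
    using * word_map_bdry by (intro sum.cong arg_cong2[where f="(*)"] refl) auto
qed

end

context regular_harmonic_structure
begin

lemma bdry_energy_nonneg: "0 \<le> bdry_energy S u u"
proof -
  have "0 \<le> conductance S p q * (u p - u q) * (u p - u q)" if "p \<in> bdry S" "q \<in> bdry S" for p q
    using conductance_nonneg[OF that] by (simp add: mult.assoc)
  then show ?thesis
    unfolding bdry_energy_def by (simp add: sum_nonneg)
qed

lemma word_renorm_pos: "0 < word_renorm S w"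
  by (induction w) (auto simp: renorm_pos)

lemma level_energy_nonneg: "0 \<le> level_energy S m u u"
  unfolding level_energy_def
  by (intro sum_nonneg mult_nonneg_nonneg bdry_energy_nonneg) (simp add: word_renorm_pos less_imp_le)

lemma level_energy_le_Suc: "level_energy S m u u \<le> level_energy S (Suc m) u u"
proof (induction m arbitrary: u)
  case 0
  then show ?case using trace_le[of u u] by simp
next
  case (Suc m)
  then show ?case
    unfolding level_energy_Suc[of S m] level_energy_Suc[of S "Suc m"]
    by (intro sum_mono mult_left_mono) (auto simp: renorm_pos less_imp_le)
qed

lemma level_energy_mono: "m \<le> n \<Longrightarrow> level_energy S m u u \<le> level_energy S n u u"
  by (rule lift_Suc_mono_le[of "\<lambda>m. level_energy S m u u"]) (use level_energy_le_Suc in auto)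

text \<open>By self-similarity the energy of \<open>u\<close> on a cell, rescaled by the resistance factor of the
  cell, is one of the nonnegative summands of the energy of \<open>u\<close>.\<close>

lemma level_energy_cell:
  "level_energy S m (u \<circ> word_map S w) (u \<circ> word_map S w)
     \<le> word_renorm S w * level_energy S (length w + m) u u"
proof (induction w arbitrary: u)
  case (Cons i w)
  have "inverse (renorm S i) * level_energy S (length w + m) (u \<circ> maps S i) (u \<circ> maps S i)
    \<le> level_energy S (Suc (length w + m)) u u"
    unfolding level_energy_Suc
    by (rule member_le_sum)
      (auto intro!: mult_nonneg_nonneg level_energy_nonneg simp: renorm_pos less_imp_le)
  then have "level_energy S (length w + m) (u \<circ> maps S i) (u \<circ> maps S i)
    \<le> renorm S i * level_energy S (Suc (length w + m)) u u"
    using renorm_pos[of i] by (simp add: divide_simps mult.commute)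
  then have "word_renorm S w * level_energy S (length w + m) (u \<circ> maps S i) (u \<circ> maps S i)
    \<le> word_renorm S w * (renorm S i * level_energy S (Suc (length w + m)) u u)"
    using word_renorm_pos[of w] by (intro mult_left_mono) auto
  with Cons[of "u \<circ> maps S i"]
  have "level_energy S m ((u \<circ> maps S i) \<circ> word_map S w) ((u \<circ> maps S i) \<circ> word_map S w)
      \<le> word_renorm S w * (renorm S i * level_energy S (Suc (length w + m)) u u)"
    by (rule order_trans)
  then show ?case
    by (simp only: word_map_Cons word_renorm_Cons comp_assoc list.size add_Suc add_Suc_right
        add_0_right mult.left_commute mult.assoc)
qed simp

lemma level_energy_step:
  "level_energy S m (u \<circ> maps S i) (u \<circ> maps S i) \<le> renorm S i * level_energy S (Suc m) u u"
  using level_energy_cell[of m u "[i]"] by simp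

lemma renorm_bound:
  obtains \<rho> where "0 < \<rho>" "\<rho> < 1" "\<And>w. word_renorm S w \<le> \<rho> ^ length w" "\<And>i. renorm S i \<le> \<rho>"
proof -
  define \<rho> where "\<rho> = Max (range (renorm S))"
  have le: "renorm S i \<le> \<rho>" for i by (simp add: \<rho>_def)
  have "\<rho> \<in> range (renorm S)" unfolding \<rho>_def by (rule Max_in) auto
  then have \<rho>: "0 < \<rho>" "\<rho> < 1" using renorm_pos regular by auto
  have "word_renorm S w \<le> \<rho> ^ length w" for w
  proof (induction w)
    case (Cons i w)
    show ?case
      using mult_mono[OF le[of i] Cons] \<rho> word_renorm_pos[of w] by simp
  qed simp
  then show ?thesis using that \<rho> le by blast
qed

section \<open>Oscillation is controlled by energy\<close>

lemma square_diff_le: "(a - c)\<^sup>2 \<le> 2 * (a - b)\<^sup>2 + 2 * (b - c)\<^sup>2" for a b c :: real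
  using zero_le_power2[of "(a - b) - (b - c)"] by (simp add: power2_eq_square algebra_simps)

lemma square_bound_trans:
  fixes Q :: "('a \<Rightarrow> real) \<Rightarrow> real"
  assumes "\<And>u. (u p - u q)\<^sup>2 \<le> c * Q u" "\<And>u. (u q - u r)\<^sup>2 \<le> d * Q u"
  shows "(u p - u r)\<^sup>2 \<le> (2 * c + 2 * d) * Q u"
  using square_diff_le[of "u p" "u r" "u q"] assms[of u] by (simp add: algebra_simps)

lemma edge_le_bdry_energy:
  assumes "p \<in> bdry S" "q \<in> bdry S"
  shows "conductance S p q * (u p - u q)\<^sup>2 \<le> 2 * bdry_energy S u u"
proof -
  have nn: "0 \<le> conductance S a b * (u a - u b) * (u a - u b)" if "a \<in> bdry S" "b \<in> bdry S" for a b
    using conductance_nonneg[OF that] by (simp add: mult.assoc)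
  have "conductance S p q * (u p - u q) * (u p - u q) \<le>
      (\<Sum>b\<in>bdry S. conductance S p b * (u p - u b) * (u p - u b))"
    by (rule member_le_sum) (use assms nn bdry_finite in auto)
  also have "\<dots> \<le> (\<Sum>a\<in>bdry S. \<Sum>b\<in>bdry S. conductance S a b * (u a - u b) * (u a - u b))"
    by (rule member_le_sum[where f="\<lambda>a. \<Sum>b\<in>bdry S. conductance S a b * (u a - u b) * (u a - u b)"])
      (use assms nn bdry_finite in \<open>auto intro!: sum_nonneg\<close>)
  finally show ?thesis by (simp add: bdry_energy_def power2_eq_square mult.assoc)
qed

text \<open>The indicator of the set of boundary points that are linked to \<open>p\<close> by such an estimate has
  no jump across an edge of positive conductance, hence has energy zero.\<close>

lemma bdry_resistance_pair:
  assumes p: "p \<in> bdry S" and q: "q \<in> bdry S"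
  shows "\<exists>c. \<forall>u. (u p - u q)\<^sup>2 \<le> c * bdry_energy S u u"
proof -
  define A where "A = {q. \<exists>c. \<forall>u. (u p - u q)\<^sup>2 \<le> c * bdry_energy S u u}"
  have step: "b \<in> A" if ab: "a \<in> bdry S" "b \<in> bdry S" "a \<in> A" "conductance S a b \<noteq> 0" for a b
  proof -
    have pos: "0 < conductance S a b" using conductance_nonneg[OF ab(1,2)] ab(4) by simp
    have "(u a - u b)\<^sup>2 \<le> (2 / conductance S a b) * bdry_energy S u u" for u
      using edge_le_bdry_energy[OF ab(1,2), of u] pos by (simp add: field_simps)
    moreover obtain c where "(u p - u a)\<^sup>2 \<le> c * bdry_energy S u u" for u
      using ab(3) by (auto simp: A_def)
    ultimately show ?thesis
      using square_bound_trans[of p a c "\<lambda>u. bdry_energy S u u" b] unfolding A_def by blast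
  qed
  have zero: "conductance S a b * (indicat_real A a - indicat_real A b) *
      (indicat_real A a - indicat_real A b) = 0" if "a \<in> bdry S" "b \<in> bdry S" for a b
    using step[of a b] step[of b a] that conductance_sym[of a b] by (auto simp: indicator_def)
  have "bdry_energy S (indicat_real A) (indicat_real A) = 0"
    unfolding bdry_energy_def by (simp only: mult_zero_right sum.neutral_const zero cong: sum.cong)
  then have "indicat_real A p = indicat_real A q"
    by (rule irreducible[OF _ p q])
  moreover have "p \<in> A" by (auto simp: A_def intro!: exI[of _ 0])
  ultimately show ?thesis by (auto simp: A_def indicator_def split: if_splits)
qed

text \<open>Within one cell the previous estimate applies; connectedness of the graph of cells, where
  touching cells share a vertex, links any two cells.\<close>

lemma first_level_resistance_pair:
  assumes x: "x \<in> verts 1" and y: "y \<in> verts 1"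
  shows "\<exists>c. \<forall>u. (u x - u y)\<^sup>2 \<le> c * level_energy S 1 u u"
proof -
  define R where "R x y \<longleftrightarrow> (\<exists>c. \<forall>u. (u x - u y)\<^sup>2 \<le> c * level_energy S 1 u u)" for x y :: 'a
  have R_trans: "R a d" if "R a b" "R b d" for a b d
  proof -
    obtain c c' where "(u a - u b)\<^sup>2 \<le> c * level_energy S 1 u u"
      "(u b - u d)\<^sup>2 \<le> c' * level_energy S 1 u u" for u
      using \<open>R a b\<close> \<open>R b d\<close> unfolding R_def by blast
    then show ?thesis
      unfolding R_def using square_bound_trans[of a b c "\<lambda>u. level_energy S 1 u u" d c'] by blast
  qed
  have R_cell: "R (maps S i a) (maps S i b)" if ab: "a \<in> bdry S" "b \<in> bdry S" for i a b
  proof -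
    obtain c where c: "(u a - u b)\<^sup>2 \<le> c * bdry_energy S u u" for u :: "'a \<Rightarrow> real"
      using bdry_resistance_pair[OF ab] by blast
    have "(u (maps S i a) - u (maps S i b))\<^sup>2 \<le> (\<bar>c\<bar> * renorm S i) * level_energy S 1 u u" for u
    proof -
      have "(u (maps S i a) - u (maps S i b))\<^sup>2 \<le> c * bdry_energy S (u \<circ> maps S i) (u \<circ> maps S i)"
        using c[of "u \<circ> maps S i"] by simp
      also have "\<dots> \<le> \<bar>c\<bar> * bdry_energy S (u \<circ> maps S i) (u \<circ> maps S i)"
        by (intro mult_right_mono bdry_energy_nonneg) simp
      also have "\<dots> \<le> \<bar>c\<bar> * (renorm S i * level_energy S 1 u u)"
        using level_energy_step[of 0 u i] by (intro mult_left_mono) (auto simp: level_energy_0)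
      finally show ?thesis by (simp add: mult.assoc)
    qed
    then show ?thesis unfolding R_def by blast
  qed
  obtain i a j b where ij: "a \<in> bdry S" "x = maps S i a" "b \<in> bdry S" "y = maps S j b"
    using x y by auto
  \<comment> \<open>The cells all of whose vertices are linked to \<open>x\<close>: a touching cell shares a vertex with them.\<close>
  have "j \<in> {j. \<forall>b\<in>bdry S. R x (maps S j b)}"
  proof (rule cell_graph_connected[of i])
    fix j k assume j: "j \<in> {j. \<forall>b\<in>bdry S. R x (maps S j b)}"
      and meet: "maps S j ` attractor S \<inter> maps S k ` attractor S \<noteq> {}"
    show "k \<in> {j. \<forall>b\<in>bdry S. R x (maps S j b)}"
    proof (cases "j = k")
      case False
      from meet obtain z where "z \<in> maps S j ` attractor S \<inter> maps S k ` attractor S" by auto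
      then have "z \<in> maps S j ` bdry S \<inter> maps S k ` bdry S"
        using cells_inter[OF False] by (rule subsetD[rotated])
      then have z: "z \<in> maps S j ` bdry S" "z \<in> maps S k ` bdry S" by simp_all
      from z(1) obtain b where b1: "b \<in> bdry S" "z = maps S j b" by (elim imageE)
      from z(2) obtain b' where b2: "b' \<in> bdry S" "z = maps S k b'" by (elim imageE)
      have b: "b \<in> bdry S" "b' \<in> bdry S" "maps S j b = maps S k b'" using b1 b2 by simp_all
      then have "R x (maps S k b')" using j by (metis mem_Collect_eq)
      then have "R x (maps S k a)" if "a \<in> bdry S" for a
        using R_trans R_cell[OF b(2) that] by metis
      then show ?thesis by simp
    qed (use j in simp)
  qed (use ij R_cell in auto)
  then show ?thesis using ij unfolding R_def by blast
qed

lemma finite_verts: "finite (verts m)"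
  by (induction m) (auto simp: bdry_finite)

text \<open>For two boundary points the energy of level zero is enough: the first-level estimate applies to
  an extension with the same energy.\<close>

lemma first_level_resistance:
  obtains c where "0 \<le> c"
    "\<And>u x y. \<lbrakk>x \<in> verts 1; y \<in> verts 1\<rbrakk> \<Longrightarrow> \<bar>u x - u y\<bar> \<le> c * sqrt (level_energy S 1 u u)"
    "\<And>u x y. \<lbrakk>x \<in> bdry S; y \<in> bdry S\<rbrakk> \<Longrightarrow> \<bar>u x - u y\<bar> \<le> c * sqrt (level_energy S 0 u u)"
proof -
  have "\<forall>x\<in>verts 1. \<forall>y\<in>verts 1. \<exists>c. \<forall>u. (u x - u y)\<^sup>2 \<le> c * level_energy S 1 u u"
    using first_level_resistance_pair by blast
  then obtain c where c: "\<And>x y u. x \<in> verts 1 \<Longrightarrow> y \<in> verts 1 \<Longrightarrow>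
      (u x - u y)\<^sup>2 \<le> c x y * level_energy S 1 u u"
    by metis
  define C where "C = (\<Sum>x\<in>verts 1. \<Sum>y\<in>verts 1. \<bar>c x y\<bar>)"
  have C0: "0 \<le> C" unfolding C_def by (intro sum_nonneg) auto
  have cC: "\<bar>c x y\<bar> \<le> C" if "x \<in> verts 1" "y \<in> verts 1" for x y
  proof -
    have "\<bar>c x y\<bar> \<le> (\<Sum>y\<in>verts 1. \<bar>c x y\<bar>)"
      by (rule member_le_sum[where f="\<lambda>y. \<bar>c x y\<bar>"]) (use that finite_verts in \<open>auto simp del: verts.simps\<close>)
    also have "\<dots> \<le> C" unfolding C_def
      by (rule member_le_sum[where f="\<lambda>x. \<Sum>y\<in>verts 1. \<bar>c x y\<bar>"])
        (use that finite_verts in \<open>auto intro: sum_nonneg simp del: verts.simps\<close>)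
    finally show ?thesis .
  qed
  have sq: "(u x - u y)\<^sup>2 \<le> C * level_energy S 1 u u" if "x \<in> verts 1" "y \<in> verts 1" for x y u
  proof -
    have "c x y * level_energy S 1 u u \<le> C * level_energy S 1 u u"
      by (rule mult_right_mono[OF _ level_energy_nonneg]) (use cC[OF that] in simp)
    then show ?thesis using c[OF that, of u] by simp
  qed
  have one: "\<bar>u x - u y\<bar> \<le> sqrt C * sqrt (level_energy S 1 u u)"
    if "x \<in> verts 1" "y \<in> verts 1" for x y u
    using real_sqrt_le_mono[OF sq[OF that, of u]] by (simp add: real_sqrt_mult)
  have zero: "\<bar>u x - u y\<bar> \<le> sqrt C * sqrt (level_energy S 0 u u)"
    if "x \<in> bdry S" "y \<in> bdry S" for x y u
  proof -
    obtain v where v: "\<forall>p\<in>bdry S. v p = u p" "level_energy S 1 v v = level_energy S 0 u u"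
      using trace_attained by blast
    show ?thesis
      using one[of x y v] that bdry_in_verts v by (metis)
  qed
  show ?thesis using that[of "sqrt C"] C0 one zero by simp
qed

text \<open>A vertex of level \<open>m\<close> is joined to the boundary by a chain of vertices of successive levels.  With
  \<open>\<rho> = max r\<^sub>i < 1\<close>, the pullback of \<open>u\<close> to a cell of level \<open>k\<close> has at most \<open>\<rho>\<^sup>k\<close> times the energy of
  \<open>u\<close>, so the jumps of \<open>u\<close> along the chain are dominated by a geometric series of ratio \<open>\<surd>\<rho>\<close>.\<close>

lemma verts_resistance:
  obtains C where "0 \<le> C"
    "\<And>m u x y. \<lbrakk>x \<in> verts m; y \<in> verts m\<rbrakk> \<Longrightarrow> \<bar>u x - u y\<bar> \<le> C * sqrt (level_energy S m u u)"
proof -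
  obtain c where c: "0 \<le> c"
    "\<And>u x y. \<lbrakk>x \<in> verts 1; y \<in> verts 1\<rbrakk> \<Longrightarrow> \<bar>u x - u y\<bar> \<le> c * sqrt (level_energy S 1 u u)"
    "\<And>u x y. \<lbrakk>x \<in> bdry S; y \<in> bdry S\<rbrakk> \<Longrightarrow> \<bar>u x - u y\<bar> \<le> c * sqrt (level_energy S 0 u u)"
    using first_level_resistance by metis
  obtain \<rho> where \<rho>: "0 < \<rho>" "\<rho> < 1" "\<And>i. renorm S i \<le> \<rho>" using renorm_bound by metis
  have s1: "sqrt \<rho> < 1" using \<rho> by simp
  \<comment> \<open>The fixed point of \<open>C \<mapsto> \<surd>\<rho> C + c\<close>, which is what one more level does to the constant.\<close>
  define C where "C = c / (1 - sqrt \<rho>)"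
  have C: "0 \<le> C" "sqrt \<rho> * C + c = C" using c(1) s1 by (auto simp: C_def field_simps)
  have cC: "c \<le> C" using C c(1) \<rho> by (smt (verit) mult_nonneg_nonneg real_sqrt_ge_zero)
  have *: "\<bar>u x - u q\<bar> \<le> C * sqrt (level_energy S m u u)" if "x \<in> verts m" "q \<in> bdry S" for m u x q
    using that(1)
  proof (induction m arbitrary: x u)
    case 0
    have "\<bar>u x - u q\<bar> \<le> c * sqrt (level_energy S 0 u u)" using c(3) 0 that by simp
    also have "\<dots> \<le> C * sqrt (level_energy S 0 u u)"
      by (intro mult_right_mono cC real_sqrt_ge_zero level_energy_nonneg)
    finally show ?case .
  next
    case (Suc m)
    let ?e = "level_energy S (Suc m) u u"
    obtain i y where y: "y \<in> verts m" "x = maps S i y" using Suc.prems by auto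
    have "\<bar>(u \<circ> maps S i) y - (u \<circ> maps S i) q\<bar>
        \<le> C * sqrt (level_energy S m (u \<circ> maps S i) (u \<circ> maps S i))"
      by (rule Suc.IH[OF y(1)])
    also have "\<dots> \<le> C * sqrt (\<rho> * ?e)"
    proof (intro mult_left_mono real_sqrt_le_mono C)
      have "level_energy S m (u \<circ> maps S i) (u \<circ> maps S i) \<le> renorm S i * ?e"
        by (rule level_energy_step)
      also have "\<dots> \<le> \<rho> * ?e" by (intro mult_right_mono \<rho> level_energy_nonneg)
      finally show "level_energy S m (u \<circ> maps S i) (u \<circ> maps S i) \<le> \<rho> * ?e" .
    qed
    finally have 1: "\<bar>u x - u (maps S i q)\<bar> \<le> sqrt \<rho> * C * sqrt ?e"
      using y by (simp add: real_sqrt_mult mult_ac)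
    have "\<bar>u (maps S i q) - u q\<bar> \<le> c * sqrt (level_energy S 1 u u)"
    proof (rule c(2))
      show "maps S i q \<in> verts 1" using that by auto
      show "q \<in> verts 1" by (rule bdry_in_verts[OF that(2)])
    qed
    also have "\<dots> \<le> c * sqrt ?e"
      by (intro mult_left_mono real_sqrt_le_mono level_energy_mono c) simp
    finally have "\<bar>u x - u q\<bar> \<le> (sqrt \<rho> * C + c) * sqrt ?e"
      using 1 by (simp add: algebra_simps)
    then show ?case using C by simp
  qed
  have "\<bar>u x - u y\<bar> \<le> (2 * C) * sqrt (level_energy S m u u)" if "x \<in> verts m" "y \<in> verts m" for m u x y
  proof (cases "bdry S = {}")
    case True
    then have "verts m = {}" by (induction m) auto
    then show ?thesis using that by simp
  next
    case False
    then obtain q where q: "q \<in> bdry S" by auto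
    show ?thesis using *[OF that(1) q, of u] *[OF that(2) q, of u] by simp
  qed
  then show ?thesis using that[of "2 * C"] C by simp
qed

text \<open>Uniform equicontinuity on the vertices: two nearby points lie in touching cells of a high
  level, which share a vertex, and on each of these cells the oscillation is small.\<close>

lemma verts_equicontinuous:
  assumes "0 < e"
  obtains d where "0 < d"
    "\<And>u B x y. \<lbrakk>\<And>m. level_energy S m u u \<le> B; x \<in> all_verts; y \<in> all_verts; dist x y < d\<rbrakk>
      \<Longrightarrow> \<bar>u x - u y\<bar> \<le> e * sqrt B"
proof -
  obtain C where C: "0 \<le> C"
    "\<And>m u x y. \<lbrakk>x \<in> verts m; y \<in> verts m\<rbrakk> \<Longrightarrow> \<bar>u x - u y\<bar> \<le> C * sqrt (level_energy S m u u)"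
    using verts_resistance by metis
  obtain \<rho> where \<rho>: "0 < \<rho>" "\<rho> < 1" "\<And>w. word_renorm S w \<le> \<rho> ^ length w" using renorm_bound by metis
  \<comment> \<open>The level at which the oscillations on two cells add up to at most \<open>e \<surd>B\<close>; the summand 1
    avoids a division by zero.\<close>
  obtain n where n: "sqrt \<rho> ^ n < e / (2 * C + 1)"
    using real_arch_pow_inv[of "e / (2 * C + 1)" "sqrt \<rho>"] \<rho> assms C by auto
  have n': "2 * C * sqrt \<rho> ^ n \<le> e"
  proof -
    have "2 * C * sqrt \<rho> ^ n \<le> (2 * C + 1) * sqrt \<rho> ^ n" using \<rho> by (simp add: mult_right_mono)
    also have "\<dots> \<le> e" using n C by (simp add: field_simps)
    finally show ?thesis .
  qed
  obtain d where d: "0 < d"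
    "\<And>w w' x y. \<lbrakk>length w = n; length w' = n; x \<in> word_map S w ` attractor S;
       y \<in> word_map S w' ` attractor S; dist x y < d\<rbrakk>
      \<Longrightarrow> word_map S w ` attractor S \<inter> word_map S w' ` attractor S \<noteq> {}"
    using close_points_touching_cells by blast
  have "\<bar>u x - u y\<bar> \<le> e * sqrt B"
    if B: "\<And>m. level_energy S m u u \<le> B" and xy: "x \<in> all_verts" "y \<in> all_verts" "dist x y < d" for u B x y
  proof -
    have B0: "0 \<le> B" using B[of 0] level_energy_nonneg[of 0 u] by simp
    have cell: "\<bar>u (word_map S w a) - u (word_map S w b)\<bar> \<le> C * sqrt \<rho> ^ n * sqrt B"
      if w: "length w = n" and ab: "a \<in> verts m" "b \<in> verts m" for w a b m
    proof -
      have "level_energy S m (u \<circ> word_map S w) (u \<circ> word_map S w)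
          \<le> word_renorm S w * level_energy S (length w + m) u u"
        by (rule level_energy_cell)
      also have "\<dots> \<le> \<rho> ^ n * B"
        by (intro mult_mono B level_energy_nonneg) (use \<rho> w in auto)
      finally have le: "level_energy S m (u \<circ> word_map S w) (u \<circ> word_map S w) \<le> \<rho> ^ n * B" .
      have "\<bar>(u \<circ> word_map S w) a - (u \<circ> word_map S w) b\<bar>
          \<le> C * sqrt (level_energy S m (u \<circ> word_map S w) (u \<circ> word_map S w))"
        by (rule C(2)[OF ab])
      also have "\<dots> \<le> C * sqrt (\<rho> ^ n * B)"
        by (intro mult_left_mono real_sqrt_le_mono le C)
      finally show ?thesis by (simp add: real_sqrt_mult real_sqrt_power mult.assoc)
    qed
    obtain m1 m2 where "x \<in> verts m1" "y \<in> verts m2" using xy by (auto simp: all_verts_def)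
    then obtain m where m: "x \<in> verts (n + m)" "y \<in> verts (n + m)"
      using verts_mono[of m1 "n + (m1 + m2)"] verts_mono[of m2 "n + (m1 + m2)"]
      by (meson le_add1 le_add2 order_trans subsetD trans_le_add2)
    obtain w a where wa: "length w = n" "a \<in> verts m" "x = word_map S w a" using verts_add_cases m by blast
    obtain w' b where wb: "length w' = n" "b \<in> verts m" "y = word_map S w' b" using verts_add_cases m by blast
    have C2: "C * sqrt \<rho> ^ n * sqrt B \<ge> 0" using C \<rho> B0 by simp
    have "\<bar>u x - u y\<bar> \<le> 2 * (C * sqrt \<rho> ^ n * sqrt B)"
    proof (cases "w = w'")
      case True
      then show ?thesis using cell[OF wa(1,2) wb(2)] wa wb C2 by simp
    next
      case False
      have "word_map S w ` attractor S \<inter> word_map S w' ` attractor S \<noteq> {}"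
        by (rule d(2)[of w w' x y]) (use wa wb xy verts_subset_attractor in auto)
      then obtain z where z: "z \<in> word_map S w ` attractor S" "z \<in> word_map S w' ` attractor S" by auto
      have "z \<in> word_map S w ` bdry S" "z \<in> word_map S w' ` bdry S"
        using word_cells_inter[of w w' z] word_cells_inter[of w' w z] z wa wb False by auto
      then obtain p q where "p \<in> bdry S" "q \<in> bdry S" "z = word_map S w p" "z = word_map S w' q" by auto
      then show ?thesis
        using cell[OF wa(1,2) bdry_in_verts, of p] cell[OF wb(1) bdry_in_verts wb(2), of q] wa wb by simp
    qed
    also have "\<dots> \<le> e * sqrt B"
      using mult_right_mono[OF n', of "sqrt B"] B0 by (simp add: mult.assoc)
    finally show ?thesis .
  qed
  then show ?thesis using that d by blast
qed

end

section \<open>The energy form\<close>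

lemma nonneg_quadratic_discriminant:
  fixes a b c :: real
  assumes "\<And>t. 0 \<le> a + 2 * t * b + t\<^sup>2 * c"
  shows "b\<^sup>2 \<le> a * c"
proof (cases "c = 0")
  case True
  have "b = 0"
  proof (rule ccontr)
    assume b: "b \<noteq> 0"
    then show False using assms[of "- (a + 1) / (2 * b)"] True by (simp add: field_simps)
  qed
  then show ?thesis using True by simp
next
  case False
  have c: "0 < c"
  proof (rule ccontr)
    assume "\<not> 0 < c"
    then have c: "c < 0" using False by simp
    have "0 \<le> 2 * a + 2 * t\<^sup>2 * c" for t using assms[of t] assms[of "-t"] by simp
    from this[of "sqrt ((\<bar>a\<bar> + 1) / - c)"] show False
      using c by (simp add: divide_simps split: if_splits)
  qed
  have "0 \<le> a + 2 * (- b / c) * b + (- b / c)\<^sup>2 * c" by (rule assms)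
  then show ?thesis using c by (simp add: power2_eq_square field_simps)
qed

lemma level_energy_const: "level_energy S m (\<lambda>x. c) v = 0"
  by (simp add: level_energy_def bdry_energy_def o_def)

lemma level_energy_split:
  "level_energy S (m + n) u v =
    (\<Sum>w | length w = m. inverse (word_renorm S w) *
       level_energy S n (u \<circ> word_map S w) (v \<circ> word_map S w))"
proof (induction m arbitrary: u v)
  case 0
  have "{w :: 'a list. length w = 0} = {[]}" by auto
  then show ?case by simp
next
  case (Suc m)
  show ?case
    by (simp add: level_energy_Suc Suc.IH sum_words_Suc sum_distrib_left mult.assoc comp_assoc)
qed

context regular_harmonic_structure
begin

text \<open>Level energies increase with the level, so a bound makes them converge.\<close>

lemma dom_energyI:
  assumes "continuous_on (attractor S) u" "\<And>m. level_energy S m u u \<le> B"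
  shows "u \<in> dom_energy S"
proof -
  have "incseq (\<lambda>m. level_energy S m u u)"
    unfolding incseq_def using level_energy_mono by blast
  then obtain L where "(\<lambda>m. level_energy S m u u) \<longlonglongrightarrow> L"
    using incseq_convergent assms(2) by blast
  then show ?thesis unfolding dom_energy_def using assms(1) by (auto simp: convergent_def)
qed

lemma dom_energy_continuous: "u \<in> dom_energy S \<Longrightarrow> continuous_on (attractor S) u"
  by (simp add: dom_energy_def)

lemma level_energy_tendsto_self:
  "u \<in> dom_energy S \<Longrightarrow> (\<lambda>m. level_energy S m u u) \<longlonglongrightarrow> energy S u u"
  unfolding energy_def dom_energy_def by (simp add: convergent_LIMSEQ_iff)

lemma level_energy_le_energy: "u \<in> dom_energy S \<Longrightarrow> level_energy S m u u \<le> energy S u u"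
  by (rule incseq_le[OF _ level_energy_tendsto_self]) (auto simp: incseq_def level_energy_mono)

lemma energy_le:
  assumes "u \<in> dom_energy S" "\<And>m. level_energy S m u u \<le> B"
  shows "energy S u u \<le> B"
  by (rule LIMSEQ_le_const2[OF level_energy_tendsto_self]) (use assms in auto)

lemma energy_nonneg: "u \<in> dom_energy S \<Longrightarrow> 0 \<le> energy S u u"
  using level_energy_le_energy[of u 0] level_energy_nonneg[of 0 u] by simp

lemma dom_energy_comb:
  assumes "u \<in> dom_energy S" "v \<in> dom_energy S"
  shows "(\<lambda>x. u x + t * v x) \<in> dom_energy S"
proof (rule dom_energyI)
  show "continuous_on (attractor S) (\<lambda>x. u x + t * v x)"
    using assms by (intro continuous_intros dom_energy_continuous)
  fix m
  have "level_energy S m (\<lambda>x. u x + t * v x) (\<lambda>x. u x + t * v x) \<le>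
      2 * level_energy S m u u + 2 * t\<^sup>2 * level_energy S m v v"
    using level_energy_nonneg[of m "\<lambda>x. u x + (-t) * v x"]
    unfolding level_energy_expand by (simp add: algebra_simps)
  also have "\<dots> \<le> 2 * energy S u u + 2 * t\<^sup>2 * energy S v v"
    by (intro add_mono mult_left_mono level_energy_le_energy assms) auto
  finally show "level_energy S m (\<lambda>x. u x + t * v x) (\<lambda>x. u x + t * v x)
    \<le> 2 * energy S u u + 2 * t\<^sup>2 * energy S v v" .
qed

lemma dom_energy_const: "(\<lambda>x. c) \<in> dom_energy S"
  by (rule dom_energyI[where B=0]) (auto simp: level_energy_const)

lemma dom_energy_diff:
  "u \<in> dom_energy S \<Longrightarrow> v \<in> dom_energy S \<Longrightarrow> (\<lambda>x. u x - v x) \<in> dom_energy S"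
  using dom_energy_comb[of u v "-1"] by simp

lemma level_energy_tendsto:
  assumes "u \<in> dom_energy S" "v \<in> dom_energy S"
  shows "(\<lambda>m. level_energy S m u v) \<longlonglongrightarrow> energy S u v"
proof -
  let ?w = "\<lambda>x. u x + 1 * v x"
  have "(\<lambda>m. (level_energy S m ?w ?w - level_energy S m u u - level_energy S m v v) / 2)
      \<longlonglongrightarrow> (energy S ?w ?w - energy S u u - energy S v v) / 2"
    by (intro tendsto_intros level_energy_tendsto_self dom_energy_comb assms) simp
  then have "convergent (\<lambda>m. level_energy S m u v)"
    unfolding level_energy_expand by (auto simp: convergent_def)
  then show ?thesis unfolding energy_def by (simp add: convergent_LIMSEQ_iff)
qed

lemma energy_commute: "energy S u v = energy S v u"
  unfolding energy_def by (subst level_energy_commute) simp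

lemma energy_comb:
  assumes "u \<in> dom_energy S" "v \<in> dom_energy S" "z \<in> dom_energy S"
  shows "energy S (\<lambda>x. u x + t * v x) z = energy S u z + t * energy S v z"
proof (rule LIMSEQ_unique)
  show "(\<lambda>m. level_energy S m (\<lambda>x. u x + t * v x) z) \<longlonglongrightarrow> energy S (\<lambda>x. u x + t * v x) z"
    by (intro level_energy_tendsto dom_energy_comb assms)
  show "(\<lambda>m. level_energy S m (\<lambda>x. u x + t * v x) z) \<longlonglongrightarrow> energy S u z + t * energy S v z"
    unfolding level_energy_add level_energy_scale
    by (intro tendsto_intros level_energy_tendsto assms)
qed

lemma energy_diff:
  assumes "u \<in> dom_energy S" "v \<in> dom_energy S" "z \<in> dom_energy S"
  shows "energy S (\<lambda>x. u x - v x) z = energy S u z - energy S v z"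
  using energy_comb[OF assms, of "-1"] by simp

lemma energy_diff_right:
  assumes "u \<in> dom_energy S" "v \<in> dom_energy S" "z \<in> dom_energy S"
  shows "energy S z (\<lambda>x. u x - v x) = energy S z u - energy S z v"
  using energy_diff[OF assms] by (simp add: energy_commute)

lemma energy_const: "energy S (\<lambda>x. c) v = 0"
  unfolding energy_def by (simp add: level_energy_const)

lemma energy_expand:
  assumes "u \<in> dom_energy S" "v \<in> dom_energy S"
  shows "energy S (\<lambda>x. u x + t * v x) (\<lambda>x. u x + t * v x) =
    energy S u u + 2 * t * energy S u v + t\<^sup>2 * energy S v v"
proof -
  have *: "energy S z (\<lambda>x. u x + t * v x) = energy S z u + t * energy S z v"
    if "z \<in> dom_energy S" for z
    using energy_comb[OF assms that, of t] by (simp add: energy_commute[of z])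
  show ?thesis
    using assms dom_energy_comb[OF assms, of t]
    by (simp add: energy_comb * energy_commute[of v u] power2_eq_square algebra_simps)
qed

lemma energy_Cauchy_Schwarz:
  assumes "u \<in> dom_energy S" "v \<in> dom_energy S"
  shows "\<bar>energy S u v\<bar> \<le> sqrt (energy S u u) * sqrt (energy S v v)"
proof -
  have "(energy S u v)\<^sup>2 \<le> energy S u u * energy S v v"
    using energy_nonneg[OF dom_energy_comb[OF assms]] energy_expand[OF assms]
    by (intro nonneg_quadratic_discriminant) simp
  from real_sqrt_le_mono[OF this] show ?thesis by (simp add: real_sqrt_mult)
qed

lemma energy_cong:
  assumes "\<And>x. x \<in> attractor S \<Longrightarrow> u x = u' x" "\<And>x. x \<in> attractor S \<Longrightarrow> v x = v' x"
  shows "energy S u v = energy S u' v'"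
proof -
  have "level_energy S m u v = level_energy S m u' v'" for m
    by (rule level_energy_cong) (use assms verts_subset_attractor in auto)
  then show ?thesis by (simp add: energy_def)
qed

lemma dom_energy_cong:
  assumes "\<And>x. x \<in> attractor S \<Longrightarrow> u x = u' x"
  shows "u \<in> dom_energy S \<longleftrightarrow> u' \<in> dom_energy S"
proof -
  have "level_energy S m u u = level_energy S m u' u'" for m
    by (rule level_energy_cong) (use assms verts_subset_attractor in auto)
  moreover have "continuous_on (attractor S) u \<longleftrightarrow> continuous_on (attractor S) u'"
    using assms by (intro continuous_on_cong) auto
  ultimately show ?thesis by (simp add: dom_energy_def)
qed

lemma dom_energy_sum:
  assumes "finite I" "\<And>i. i \<in> I \<Longrightarrow> f i \<in> dom_energy S"
  shows "(\<lambda>x. \<Sum>i\<in>I. c i * f i x) \<in> dom_energy S"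
  using assms
proof (induction I rule: finite_induct)
  case (insert i I)
  then show ?case
    using dom_energy_comb[of "\<lambda>x. \<Sum>i\<in>I. c i * f i x" "f i" "c i"] by (simp add: add.commute)
qed (simp add: dom_energy_const)

lemma energy_sum:
  assumes "finite I" "\<And>i. i \<in> I \<Longrightarrow> f i \<in> dom_energy S" "z \<in> dom_energy S"
  shows "energy S (\<lambda>x. \<Sum>i\<in>I. c i * f i x) z = (\<Sum>i\<in>I. c i * energy S (f i) z)"
  using assms
proof (induction I rule: finite_induct)
  case (insert i I)
  then show ?case
    using energy_comb[of "\<lambda>x. \<Sum>i\<in>I. c i * f i x" "f i" z "c i"]
    by (simp add: add.commute dom_energy_sum)
qed (simp add: energy_const)

lemma bdry_energy_abs_le:
  "bdry_energy S (\<lambda>x. \<bar>u x\<bar>) (\<lambda>x. \<bar>u x\<bar>) \<le> bdry_energy S u u"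
proof -
  have "(\<bar>u p\<bar> - \<bar>u q\<bar>) * (\<bar>u p\<bar> - \<bar>u q\<bar>) \<le> (u p - u q) * (u p - u q)" for p q
  proof -
    have "\<bar>\<bar>u p\<bar> - \<bar>u q\<bar>\<bar>\<^sup>2 \<le> \<bar>u p - u q\<bar>\<^sup>2" by (intro power_mono abs_triangle_ineq3) simp
    then show ?thesis by (simp add: power2_eq_square)
  qed
  then show ?thesis
    unfolding bdry_energy_def
    by (intro mult_left_mono sum_mono) (auto simp: mult.assoc intro!: mult_left_mono conductance_nonneg)
qed

lemma level_energy_abs_le:
  "level_energy S m (\<lambda>x. \<bar>u x\<bar>) (\<lambda>x. \<bar>u x\<bar>) \<le> level_energy S m u u"
  unfolding level_energy_def using bdry_energy_abs_le
  by (intro sum_mono mult_left_mono) (auto simp: o_def word_renorm_pos less_imp_le)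

lemma abs_dom_energy:
  assumes "u \<in> dom_energy S"
  shows "(\<lambda>x. \<bar>u x\<bar>) \<in> dom_energy S" "energy S (\<lambda>x. \<bar>u x\<bar>) (\<lambda>x. \<bar>u x\<bar>) \<le> energy S u u"
proof -
  have le: "level_energy S m (\<lambda>x. \<bar>u x\<bar>) (\<lambda>x. \<bar>u x\<bar>) \<le> energy S u u" for m
    using level_energy_abs_le level_energy_le_energy[OF assms] by (rule order_trans)
  show d: "(\<lambda>x. \<bar>u x\<bar>) \<in> dom_energy S"
    by (rule dom_energyI[OF _ le]) (intro continuous_intros dom_energy_continuous assms)
  show "energy S (\<lambda>x. \<bar>u x\<bar>) (\<lambda>x. \<bar>u x\<bar>) \<le> energy S u u"
    by (rule energy_le[OF d le])
qed

lemma tendsto_level_energy: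
  assumes "\<And>x. x \<in> attractor S \<Longrightarrow> (\<lambda>k. f k x) \<longlonglongrightarrow> g x"
  shows "(\<lambda>k. level_energy S m (f k) (f k)) \<longlonglongrightarrow> level_energy S m g g"
  unfolding level_energy_def bdry_energy_def o_def
  by (intro tendsto_sum tendsto_mult tendsto_diff tendsto_const assms word_map_in_attractor)
    (use bdry_subset in auto)

section \<open>Harmonic extension\<close>

text \<open>The extension by one level is done inside each first-level cell separately.  The pieces fit
  together because two cells meet only in vertices that are images of boundary points, where the
  values were prescribed beforehand.\<close>

lemma harmonic_extension_step:
  "\<exists>v. (\<forall>x\<in>verts m. v x = u x) \<and> level_energy S (Suc m) v v = level_energy S m u u"
proof (induction m arbitrary: u)
  case 0
  then show ?case using trace_attained[of u] by simp
next
  case (Suc m)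
  have "\<forall>i. \<exists>v. (\<forall>x\<in>verts m. v x = (u \<circ> maps S i) x) \<and>
      level_energy S (Suc m) v v = level_energy S m (u \<circ> maps S i) (u \<circ> maps S i)"
    using Suc by blast
  then obtain V where V: "\<And>i x. x \<in> verts m \<Longrightarrow> V i x = u (maps S i x)"
    "\<And>i. level_energy S (Suc m) (V i) (V i) = level_energy S m (u \<circ> maps S i) (u \<circ> maps S i)"
    by (metis comp_apply)
  define cell where "cell x = (SOME i. x \<in> maps S i ` attractor S)" for x
  define v where "v x = (if x \<in> verts (Suc m) then u x
    else V (cell x) (inv (maps S (cell x)) x))" for x
  \<comment> \<open>Only points of \<open>V\<^sub>1\<close> lie in several cells, so the choice of a cell affects no new vertex.\<close>
  have junction: "y \<in> bdry S"
    if "i \<noteq> j" "y \<in> attractor S" "maps S i y \<in> maps S j ` attractor S" for i j y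
  proof -
    have "maps S i y \<in> maps S i ` bdry S" using cells_inter[OF that(1)] that(2,3) by blast
    then show ?thesis by auto
  qed
  have v: "v (maps S i y) = V i y" if y: "y \<in> verts (Suc m)" for i y
  proof -
    have yK: "y \<in> attractor S" using y verts_subset_attractor by blast
    show ?thesis
    proof (cases "maps S i y \<in> verts (Suc m)")
      case True
      then obtain j z where z: "z \<in> verts m" "maps S i y = maps S j z" by auto
      have "y \<in> verts m"
      proof (cases "i = j")
        case False
        have "z \<in> attractor S" using z verts_subset_attractor by blast
        then show ?thesis using junction[OF False yK] z bdry_in_verts by auto
      qed (use z in simp)
      then show ?thesis using V True by (simp add: v_def del: verts.simps)
    next
      case False
      have "maps S i y \<in> maps S (cell (maps S i y)) ` attractor S"
        unfolding cell_def by (rule someI[of _ i]) (use yK in simp)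
      moreover have "y \<notin> bdry S"
        using False bdry_in_verts[of y m] by auto
      ultimately have "cell (maps S i y) = i"
        using junction[OF _ yK, of i "cell (maps S i y)"] by metis
      then show ?thesis using False by (simp add: v_def inv_f_f[OF inj_maps] del: verts.simps)
    qed
  qed
  have "level_energy S (Suc m) (v \<circ> maps S i) (v \<circ> maps S i) =
      level_energy S m (u \<circ> maps S i) (u \<circ> maps S i)" for i
    unfolding V(2)[symmetric] by (rule level_energy_cong) (use v in \<open>auto simp del: verts.simps\<close>)
  then have "level_energy S (Suc (Suc m)) v v = level_energy S (Suc m) u u"
    unfolding level_energy_Suc[of S "Suc m"] level_energy_Suc[of S m] by simp
  moreover have "\<forall>x\<in>verts (Suc m). v x = u x" by (simp add: v_def del: verts.simps)
  ultimately show ?case by blast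
qed

end

text \<open>A boundary point, and with it the density of the vertices, is available as soon as the attractor
  has two points.\<close>

locale nontrivial_harmonic_structure = regular_harmonic_structure S
  for S :: "('i::finite, 'a::euclidean_space) fractal" +
  assumes nontrivial: "\<exists>x\<in>attractor S. \<exists>y\<in>attractor S. x \<noteq> y"
begin

lemma closure_all_verts: "closure all_verts = attractor S"
  using all_verts_dense bdry_nonempty nontrivial by metis

lemma oscillation_extends:
  fixes u :: "'a \<Rightarrow> real"
  assumes u: "continuous_on (attractor S) u"
    and le: "\<And>x y. x \<in> all_verts \<Longrightarrow> y \<in> all_verts \<Longrightarrow> dist x y < d \<Longrightarrow> \<bar>u x - u y\<bar> \<le> b"
    and xy: "x \<in> attractor S" "y \<in> attractor S" "dist x y < d"
  shows "\<bar>u x - u y\<bar> \<le> b"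
proof -
  obtain X Y where X: "\<And>n. X n \<in> all_verts" "X \<longlonglongrightarrow> x" and Y: "\<And>n. Y n \<in> all_verts" "Y \<longlonglongrightarrow> y"
    using xy unfolding closure_all_verts[symmetric] closure_sequential by blast
  have "(\<lambda>n. dist (X n) (Y n)) \<longlonglongrightarrow> dist x y" by (intro tendsto_intros X Y)
  then have ev: "\<forall>\<^sub>F n in sequentially. dist (X n) (Y n) < d" using xy(3) by (rule order_tendstoD)
  have uX: "(\<lambda>n. u (X n)) \<longlonglongrightarrow> u x"
    by (rule continuous_on_tendsto_compose[OF u X(2) xy(1)]) (use X(1) all_verts_subset in \<open>auto intro!: always_eventually\<close>)
  have uY: "(\<lambda>n. u (Y n)) \<longlonglongrightarrow> u y"
    by (rule continuous_on_tendsto_compose[OF u Y(2) xy(2)]) (use Y(1) all_verts_subset in \<open>auto intro!: always_eventually\<close>)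
  have "(\<lambda>n. \<bar>u (X n) - u (Y n)\<bar>) \<longlonglongrightarrow> \<bar>u x - u y\<bar>" by (intro tendsto_intros uX uY)
  then show ?thesis
    by (rule tendsto_upperbound) (use ev le X(1) Y(1) in \<open>auto elim!: eventually_mono\<close>)
qed

lemma resistance_bounded:
  obtains C where "0 \<le> C"
    "\<And>u x y. \<lbrakk>u \<in> dom_energy S; x \<in> attractor S; y \<in> attractor S\<rbrakk>
      \<Longrightarrow> \<bar>u x - u y\<bar> \<le> C * sqrt (energy S u u)"
proof -
  obtain C where C: "0 \<le> C"
    "\<And>m u x y. \<lbrakk>x \<in> verts m; y \<in> verts m\<rbrakk> \<Longrightarrow> \<bar>u x - u y\<bar> \<le> C * sqrt (level_energy S m u u)"
    using verts_resistance by metis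
  have "\<bar>u x - u y\<bar> \<le> C * sqrt (energy S u u)"
    if u: "u \<in> dom_energy S" and xy: "x \<in> attractor S" "y \<in> attractor S" for u x y
  proof (rule oscillation_extends[where d="dist x y + 1"])
    fix a b assume ab: "a \<in> all_verts" "b \<in> all_verts"
    then obtain m1 m2 where "a \<in> verts m1" "b \<in> verts m2" by (auto simp: all_verts_def)
    then have "a \<in> verts (max m1 m2)" "b \<in> verts (max m1 m2)"
      using verts_mono[of m1 "max m1 m2"] verts_mono[of m2 "max m1 m2"] by auto
    then have "\<bar>u a - u b\<bar> \<le> C * sqrt (level_energy S (max m1 m2) u u)" by (rule C(2))
    also have "\<dots> \<le> C * sqrt (energy S u u)"
      by (intro mult_left_mono real_sqrt_le_mono level_energy_le_energy u C)
    finally show "\<bar>u a - u b\<bar> \<le> C * sqrt (energy S u u)" .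
  qed (use u xy dom_energy_continuous in auto)
  then show ?thesis using that C(1) by blast
qed

lemma dom_energy_equicontinuous:
  assumes "0 < e"
  obtains d where "0 < d"
    "\<And>u x y. \<lbrakk>u \<in> dom_energy S; x \<in> attractor S; y \<in> attractor S; dist x y < d\<rbrakk>
      \<Longrightarrow> \<bar>u x - u y\<bar> \<le> e * sqrt (energy S u u)"
proof -
  obtain d where d: "0 < d"
    "\<And>u B x y. \<lbrakk>\<And>m. level_energy S m u u \<le> B; x \<in> all_verts; y \<in> all_verts; dist x y < d\<rbrakk>
      \<Longrightarrow> \<bar>u x - u y\<bar> \<le> e * sqrt B"
    using verts_equicontinuous[OF assms] by metis
  have "\<bar>u x - u y\<bar> \<le> e * sqrt (energy S u u)"
    if "u \<in> dom_energy S" "x \<in> attractor S" "y \<in> attractor S" "dist x y < d" for u x y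
    by (rule oscillation_extends[where d=d])
      (use that d(2)[OF level_energy_le_energy] dom_energy_continuous in auto)
  then show ?thesis using that d(1) by blast
qed

text \<open>Extending level by level prescribes values at all vertices without raising the energy.
  Bounded energy makes this function uniformly continuous, so it extends from the dense set of
  vertices to the attractor.\<close>

lemma harmonic_extension:
  obtains h where "h \<in> dom_energy S" "\<And>x. x \<in> verts m \<Longrightarrow> h x = u x"
    "\<And>n. level_energy S (m + n) h h = level_energy S m u u"
proof -
  define ext where "ext k g = (SOME v. (\<forall>x\<in>verts (m + k). v x = g x) \<and>
     level_energy S (Suc (m + k)) v v = level_energy S (m + k) g g)" for k and g :: "'a \<Rightarrow> real"
  define s where "s = rec_nat u ext"
  have s0: "s 0 = u" by (simp add: s_def)
  have "(\<forall>x\<in>verts (m + k). s (Suc k) x = s k x) \<and>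
     level_energy S (Suc (m + k)) (s (Suc k)) (s (Suc k)) = level_energy S (m + k) (s k) (s k)" for k
    using someI_ex[OF harmonic_extension_step[of "m + k" "s k"]]
    by (simp add: s_def ext_def)
  then have step: "\<And>k x. x \<in> verts (m + k) \<Longrightarrow> s (Suc k) x = s k x"
    "\<And>k. level_energy S (m + Suc k) (s (Suc k)) (s (Suc k)) = level_energy S (m + k) (s k) (s k)"
    by auto
  have stable: "s (k + j) x = s k x" if "x \<in> verts (m + k)" for k j x
  proof (induction j)
    case (Suc j)
    have "x \<in> verts (m + (k + j))" using that verts_mono[of "m + k" "m + (k + j)"] by auto
    then show ?case using step(1)[of x "k + j"] Suc by simp
  qed simp
  \<comment> \<open>A vertex keeps the value that it received at the first level where it appears.\<close>
  define f where "f x = s (LEAST k. x \<in> verts (m + k)) x" for x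
  have f: "f x = s k x" if "x \<in> verts (m + k)" for k x
  proof -
    let ?l = "LEAST k. x \<in> verts (m + k)"
    have "x \<in> verts (m + ?l)" "?l \<le> k"
      using LeastI[of "\<lambda>k. x \<in> verts (m + k)"] Least_le[of "\<lambda>k. x \<in> verts (m + k)"] that by auto
    then show ?thesis using stable[of x ?l "k - ?l"] by (simp add: f_def)
  qed
  have sk: "level_energy S (m + k) (s k) (s k) = level_energy S m u u" for k
    by (induction k) (use step s0 in simp_all)
  have lf: "level_energy S (m + k) f f = level_energy S m u u" for k
    unfolding sk[of k, symmetric] by (rule level_energy_cong) (use f in auto)
  have B: "level_energy S n f f \<le> level_energy S m u u" for n
    using level_energy_mono[of n "m + n" f] lf[of n] by simp
  have "uniformly_continuous_on all_verts f"
    unfolding uniformly_continuous_on_def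
  proof (intro allI impI)
    fix e :: real assume "0 < e"
    let ?B = "level_energy S m u u"
    define e' where "e' = e / (sqrt ?B + 1)"
    have s1: "0 \<le> sqrt ?B" using level_energy_nonneg by simp
    have s2: "0 < sqrt ?B + 1" using s1 by linarith
    then have e': "0 < e'" using \<open>0 < e\<close> unfolding e'_def by (rule divide_pos_pos[rotated])
    have lt: "e' * sqrt ?B < e"
      using \<open>0 < e\<close> s2 unfolding e'_def by (simp add: field_simps)
    obtain d where d: "0 < d"
      "\<And>u B x y. \<lbrakk>\<And>m. level_energy S m u u \<le> B; x \<in> all_verts; y \<in> all_verts; dist x y < d\<rbrakk>
        \<Longrightarrow> \<bar>u x - u y\<bar> \<le> e' * sqrt B"
      using verts_equicontinuous[OF e'] by metis
    show "\<exists>d>0. \<forall>x\<in>all_verts. \<forall>x'\<in>all_verts. dist x' x < d \<longrightarrow> dist (f x') (f x) < e"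
      using d(1) d(2)[OF B] lt by (intro exI[of _ d]) (force simp: dist_real_def)
  qed
  then obtain g where g: "uniformly_continuous_on (closure all_verts) g"
    "\<And>x. x \<in> all_verts \<Longrightarrow> f x = g x"
    using uniformly_continuous_on_extension_on_closure[of all_verts f] by metis
  have lg: "level_energy S n g g = level_energy S n f f" for n
    by (rule level_energy_cong) (use g(2)[symmetric] in \<open>auto simp: all_verts_def\<close>)
  show ?thesis
  proof (rule that[of g])
    show "g \<in> dom_energy S"
      by (rule dom_energyI[where B="level_energy S m u u"])
        (use g(1) lg B closure_all_verts uniformly_continuous_imp_continuous in auto)
    show "g x = u x" if "x \<in> verts m" for x
    proof -
      have "x \<in> all_verts" using that unfolding all_verts_def by blast
      then show ?thesis using g(2)[of x] f[of x 0] that s0 by simp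
    qed
    show "level_energy S (m + n) g g = level_energy S m u u" for n
      using lg lf by simp
  qed
qed

text \<open>The energy in each cell can only grow with the level, so it stays the same in every cell if the
  total does; a cell with constant vertex values therefore keeps energy zero.\<close>

lemma constant_on_cell:
  assumes h: "h \<in> dom_energy S" "\<And>n. level_energy S (m + n) h h = level_energy S m h h"
    and w: "length w = m" "\<And>p. p \<in> bdry S \<Longrightarrow> h (word_map S w p) = c"
    and x: "x \<in> word_map S w ` attractor S"
  shows "h x = c"
proof -
  let ?g = "h \<circ> word_map S w"
  let ?e = "\<lambda>n w. level_energy S n (h \<circ> word_map S w) (h \<circ> word_map S w)"
  have "?e n w = ?e 0 w" for n
  proof -
    have "(\<Sum>w | length w = m. inverse (word_renorm S w) * (?e n w - ?e 0 w)) = 0"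
      using level_energy_split[of S m n h h] level_energy_split[of S m 0 h h] h(2)[of n]
      by (simp add: right_diff_distrib sum_subtractf)
    moreover have "0 \<le> inverse (word_renorm S w) * (?e n w - ?e 0 w)" for w
      using level_energy_mono[of 0 n] word_renorm_pos[of w] by (simp add: less_imp_le)
    ultimately have "inverse (word_renorm S w) * (?e n w - ?e 0 w) = 0"
      using w(1) by (subst (asm) sum_nonneg_eq_0_iff) auto
    then show ?thesis using word_renorm_pos[of w] by simp
  qed
  moreover have "?e 0 w = 0"
    unfolding level_energy_0 bdry_energy_def using w(2) by simp
  ultimately have e0: "?e n w = 0" for n by simp
  obtain C where C: "\<And>m u x y. \<lbrakk>x \<in> verts m; y \<in> verts m\<rbrakk> \<Longrightarrow> \<bar>u x - u y\<bar> \<le> C * sqrt (level_energy S m u u)"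
    using verts_resistance by metis
  obtain q where q: "q \<in> bdry S" using bdry_nonempty nontrivial by blast
  have const: "?g y = c" if y: "y \<in> all_verts" for y
  proof -
    obtain n where "y \<in> verts n" using y unfolding all_verts_def by blast
    then have "\<bar>?g y - ?g q\<bar> \<le> C * sqrt (?e n w)" using bdry_in_verts q by (intro C) auto
    then show ?thesis using e0[of n] w(2)[OF q] by simp
  qed
  have "continuous_on (attractor S) ?g"
    by (intro continuous_on_compose continuous_word_map
        continuous_on_subset[OF dom_energy_continuous[OF h(1)]]) auto
  then have "?g y = c" if "y \<in> attractor S" for y
    using continuous_constant_on_closure[of all_verts ?g c y] const that closure_all_verts by auto
  then show ?thesis using x by auto
qed

text \<open>The separating function is the harmonic extension of the indicator of the union of the small
  cells around the point.\<close>

lemma dom_energy_separates: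
  assumes a: "a \<in> attractor S" and E: "finite E" "E \<subseteq> attractor S" "a \<notin> E"
  obtains u where "u \<in> dom_energy S" "u a = 1" "\<And>y. y \<in> E \<Longrightarrow> u y = 0"
proof -
  obtain e where e: "0 < e" "\<And>y. y \<in> E \<Longrightarrow> e \<le> dist a y"
    using finite_set_avoid[OF E(1), of a] E(3) by metis
  obtain m where m: "\<And>w x y. \<lbrakk>length w = m; x \<in> word_map S w ` attractor S;
      y \<in> word_map S w ` attractor S\<rbrakk> \<Longrightarrow> dist x y < e / 2"
    using cells_small[of "e / 2"] e(1) by auto
  define N where "N = (\<Union>w\<in>{w. length w = m \<and> a \<in> word_map S w ` attractor S}. word_map S w ` attractor S)"
  obtain h where h: "h \<in> dom_energy S" "\<And>x. x \<in> verts m \<Longrightarrow> h x = indicat_real N x"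
    "\<And>n. level_energy S (m + n) h h = level_energy S m (indicat_real N) (indicat_real N)"
    using harmonic_extension[of m "indicat_real N"] by metis
  have cons: "level_energy S (m + n) h h = level_energy S m h h" for n
    using h(3)[of n] h(3)[of 0] by simp
  have vert: "word_map S w p \<in> verts m" if "length w = m" "p \<in> bdry S" for w p
    using word_map_bdry that by blast
  obtain w where w: "length w = m" "a \<in> word_map S w ` attractor S" using in_word_cell[OF a] by blast
  have "h a = 1"
  proof (rule constant_on_cell[OF h(1) cons w(1) _ w(2)])
    fix p assume p: "p \<in> bdry S"
    then have "word_map S w p \<in> N" using w bdry_subset by (auto simp: N_def)
    then show "h (word_map S w p) = 1" using h(2)[OF vert[OF w(1) p]] by simp
  qed
  moreover have "h y = 0" if y: "y \<in> E" for y
  proof -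
    obtain w' where w': "length w' = m" "y \<in> word_map S w' ` attractor S"
      using in_word_cell y E(2) by blast
    show ?thesis
    proof (rule constant_on_cell[OF h(1) cons w'(1) _ w'(2)])
      fix p assume p: "p \<in> bdry S"
      have "word_map S w' p \<notin> N"
      proof
        assume "word_map S w' p \<in> N"
        then obtain v where v: "length v = m" "a \<in> word_map S v ` attractor S"
          "word_map S w' p \<in> word_map S v ` attractor S" by (auto simp: N_def)
        have "dist a (word_map S w' p) < e / 2" using m v by blast
        moreover have "dist (word_map S w' p) y < e / 2" using m w' p bdry_subset by blast
        ultimately have "dist a y < e" using dist_triangle_half_r[of "word_map S w' p"]
          by (simp add: dist_commute)
        then show False using e(2)[OF y] by simp
      qed
      then show "h (word_map S w' p) = 0" using h(2)[OF vert[OF w'(1) p]] by simp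
    qed
  qed
  ultimately show ?thesis using that h(1) by blast
qed

section \<open>Riesz representation for the energy\<close>

definition vanishing :: "'a set \<Rightarrow> ('a \<Rightarrow> real) set" where
  "vanishing E = {u \<in> dom_energy S. \<forall>x\<in>E. u x = 0}"

lemma vanishingD: "u \<in> vanishing E \<Longrightarrow> u \<in> dom_energy S" "u \<in> vanishing E \<Longrightarrow> x \<in> E \<Longrightarrow> u x = 0"
  by (auto simp: vanishing_def)

lemma vanishing_comb:
  "u \<in> vanishing E \<Longrightarrow> v \<in> vanishing E \<Longrightarrow> (\<lambda>x. u x + t * v x) \<in> vanishing E"
  by (simp add: vanishing_def dom_energy_comb)

lemma vanishing_diff:
  "u \<in> vanishing E \<Longrightarrow> v \<in> vanishing E \<Longrightarrow> (\<lambda>x. u x - v x) \<in> vanishing E"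
  by (simp add: vanishing_def dom_energy_diff)

text \<open>Comparing with a node, where the value is zero, turns the oscillation bound into a bound for
  point evaluations.\<close>

lemma vanishing_bounded:
  assumes "E \<noteq> {}" "E \<subseteq> attractor S"
  obtains C where "0 \<le> C"
    "\<And>u x. \<lbrakk>u \<in> vanishing E; x \<in> attractor S\<rbrakk> \<Longrightarrow> \<bar>u x\<bar> \<le> C * sqrt (energy S u u)"
proof -
  obtain C where C: "0 \<le> C"
    "\<And>u x y. \<lbrakk>u \<in> dom_energy S; x \<in> attractor S; y \<in> attractor S\<rbrakk>
      \<Longrightarrow> \<bar>u x - u y\<bar> \<le> C * sqrt (energy S u u)"
    using resistance_bounded by metis
  obtain a where a: "a \<in> E" using assms by auto
  have "\<bar>u x\<bar> \<le> C * sqrt (energy S u u)" if "u \<in> vanishing E" "x \<in> attractor S" for u x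
    using C(2)[of u x a] vanishingD[OF that(1)] that(2) a assms(2) by auto
  then show ?thesis using that C(1) by blast
qed

lemma vanishing_energy_zero:
  assumes "E \<noteq> {}" "E \<subseteq> attractor S" "u \<in> vanishing E" "energy S u u \<le> 0" "x \<in> attractor S"
  shows "u x = 0"
proof -
  obtain C where "\<bar>u x\<bar> \<le> C * sqrt (energy S u u)"
    using vanishing_bounded[OF assms(1,2)] assms(3,5) by metis
  moreover have "energy S u u = 0"
    using energy_nonneg[OF vanishingD(1)[OF assms(3)]] assms(4) by (rule order_antisym[rotated])
  ultimately show ?thesis by simp
qed

text \<open>Completeness: an energy Cauchy sequence that vanishes at a point converges uniformly, and
  level energies, being finite sums, pass to pointwise limits.\<close>

lemma vanishing_complete:
  assumes E: "E \<noteq> {}" "E \<subseteq> attractor S"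
    and u: "\<And>n. u n \<in> vanishing E"
    and cauchy: "\<And>n k. energy S (\<lambda>x. u n x - u k x) (\<lambda>x. u n x - u k x) \<le> e n + e k"
    and e: "e \<longlonglongrightarrow> 0"
  obtains h where "h \<in> vanishing E"
    "\<And>n. energy S (\<lambda>x. u n x - h x) (\<lambda>x. u n x - h x) \<le> e n"
proof -
  obtain C where C: "0 \<le> C"
    "\<And>u x. \<lbrakk>u \<in> vanishing E; x \<in> attractor S\<rbrakk> \<Longrightarrow> \<bar>u x\<bar> \<le> C * sqrt (energy S u u)"
    using vanishing_bounded[OF E] by metis
  have e0: "0 \<le> e n" for n
    using cauchy[of n n] by (simp add: energy_const)
  define b where "b n = C * sqrt (e n)" for n
  have b0: "b \<longlonglongrightarrow> 0"
    unfolding b_def using tendsto_mult_left[OF tendsto_real_sqrt[OF e], of C] by simp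
  have ub: "\<bar>u n x - u k x\<bar> \<le> b n + b k" if x: "x \<in> attractor S" for n k x
  proof -
    have "\<bar>u n x - u k x\<bar> \<le> C * sqrt (energy S (\<lambda>x. u n x - u k x) (\<lambda>x. u n x - u k x))"
      by (rule C(2)[OF vanishing_diff[OF u u] x])
    also have "\<dots> \<le> C * sqrt (e n + e k)" by (intro mult_left_mono real_sqrt_le_mono cauchy C)
    also have "\<dots> \<le> C * (sqrt (e n) + sqrt (e k))"
      by (intro mult_left_mono sqrt_add_le_add_sqrt e0 C)
    finally show ?thesis by (simp add: b_def algebra_simps)
  qed
  define h where "h x = lim (\<lambda>n. u n x)" for x
  have lim: "(\<lambda>n. u n x) \<longlonglongrightarrow> h x" if x: "x \<in> attractor S" for x
  proof -
    have "Cauchy (\<lambda>n. u n x)"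
    proof (rule metric_CauchyI)
      fix r :: real assume "0 < r"
      then have "\<forall>\<^sub>F n in sequentially. b n < r / 2" using b0 by (intro order_tendstoD) auto
      then obtain N where N: "\<And>n. n \<ge> N \<Longrightarrow> b n < r / 2" by (auto simp: eventually_sequentially)
      show "\<exists>M. \<forall>m\<ge>M. \<forall>n\<ge>M. dist (u m x) (u n x) < r"
      proof (intro exI allI impI)
        fix m n assume "m \<ge> N" "n \<ge> N"
        then show "dist (u m x) (u n x) < r"
          using N[of m] N[of n] ub[OF x, of m n] by (simp add: dist_real_def)
      qed
    qed
    then show ?thesis unfolding h_def by (simp add: Cauchy_convergent_iff convergent_LIMSEQ_iff)
  qed
  have hb: "\<bar>u n x - h x\<bar> \<le> b n" if x: "x \<in> attractor S" for n x
  proof (rule LIMSEQ_le)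
    show "(\<lambda>k. \<bar>u n x - u k x\<bar>) \<longlonglongrightarrow> \<bar>u n x - h x\<bar>" by (intro tendsto_intros lim x)
    show "(\<lambda>k. b n + b k) \<longlonglongrightarrow> b n" using tendsto_add[OF tendsto_const b0, of "b n"] by simp
  qed (use ub x in auto)
  have "uniform_limit (attractor S) u h sequentially"
  proof (rule uniform_limitI)
    fix r :: real assume "0 < r"
    then have "\<forall>\<^sub>F n in sequentially. b n < r" using b0 by (intro order_tendstoD) auto
    then show "\<forall>\<^sub>F n in sequentially. \<forall>x\<in>attractor S. dist (u n x) (h x) < r"
    proof eventually_elim
      case (elim n)
      then show ?case using hb[of _ n] by (auto simp: dist_real_def intro: le_less_trans)
    qed
  qed
  then have cont: "continuous_on (attractor S) h"
    by (rule uniform_limit_theorem[rotated])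
      (simp_all add: dom_energy_continuous vanishingD(1)[OF u])
  have lev: "level_energy S m (\<lambda>x. u n x - h x) (\<lambda>x. u n x - h x) \<le> e n" for m n
  proof (rule LIMSEQ_le)
    show "(\<lambda>k. level_energy S m (\<lambda>x. u n x - u k x) (\<lambda>x. u n x - u k x))
      \<longlonglongrightarrow> level_energy S m (\<lambda>x. u n x - h x) (\<lambda>x. u n x - h x)"
      by (rule tendsto_level_energy) (intro tendsto_intros lim)
    show "(\<lambda>k. e n + e k) \<longlonglongrightarrow> e n" using tendsto_add[OF tendsto_const e, of "e n"] by simp
    show "\<exists>N. \<forall>k\<ge>N. level_energy S m (\<lambda>x. u n x - u k x) (\<lambda>x. u n x - u k x) \<le> e n + e k"
      using level_energy_le_energy[OF vanishingD(1)[OF vanishing_diff[OF u u]]] cauchy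
      by (meson order_trans)
  qed
  have dom: "(\<lambda>x. u n x - h x) \<in> dom_energy S" for n
    by (rule dom_energyI[OF _ lev])
      (intro continuous_intros cont dom_energy_continuous vanishingD(1)[OF u])
  have "(\<lambda>x. u 0 x - (u 0 x - h x)) \<in> dom_energy S"
    by (rule dom_energy_diff[OF vanishingD(1)[OF u] dom])
  then have "h \<in> dom_energy S" by simp
  moreover have "h x = 0" if "x \<in> E" for x
    using lim[of x] that E(2) vanishingD(2)[OF u that] by (auto simp: LIMSEQ_const_iff)
  ultimately have "h \<in> vanishing E" by (simp add: vanishing_def)
  then show ?thesis using that energy_le[OF dom lev] by blast
qed

text \<open>The representer minimises \<open>J v = \<E>(v, v) - 2 L v\<close>.  Minimising sequences are Cauchy by the
  parallelogram law, and the first variation at the minimum vanishes.\<close>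

lemma energy_riesz:
  assumes E: "E \<noteq> {}" "E \<subseteq> attractor S"
    and lin: "\<And>u v t. u \<in> vanishing E \<Longrightarrow> v \<in> vanishing E \<Longrightarrow> L (\<lambda>x. u x + t * v x) = L u + t * L v"
    and bd: "\<And>v. v \<in> vanishing E \<Longrightarrow> \<bar>L v\<bar> \<le> c * sqrt (energy S v v)"
  obtains h where "h \<in> vanishing E" "\<And>v. v \<in> vanishing E \<Longrightarrow> energy S h v = L v"
proof -
  define J where "J v = energy S v v - 2 * L v" for v
  have J_low: "- c\<^sup>2 \<le> J v" if v: "v \<in> vanishing E" for v
  proof -
    let ?s = "sqrt (energy S v v)"
    have "?s\<^sup>2 = energy S v v" using energy_nonneg vanishingD(1)[OF v] by simp
    moreover have "0 \<le> (?s - c)\<^sup>2" by simp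
    ultimately have "2 * (c * ?s) \<le> energy S v v + c\<^sup>2"
      by (simp add: power2_diff algebra_simps)
    then show ?thesis using bd[OF v] unfolding J_def by linarith
  qed
  have J_expand: "J (\<lambda>x. u x + t * v x) = J u + 2 * t * (energy S u v - L v) + t\<^sup>2 * energy S v v"
    if "u \<in> vanishing E" "v \<in> vanishing E" for u v t
    using that energy_expand[of u v t] vanishingD(1) by (simp add: J_def lin algebra_simps)
  define m where "m = Inf (J ` vanishing E)"
  have bdd: "bdd_below (J ` vanishing E)" using J_low by (auto intro!: bdd_belowI)
  have z: "(\<lambda>x. 0) \<in> vanishing E" by (simp add: vanishing_def dom_energy_const)
  have m_le: "m \<le> J v" if "v \<in> vanishing E" for v
    unfolding m_def using that bdd by (intro cInf_lower) auto
  have "\<exists>v\<in>vanishing E. J v < m + 1 / real (Suc n)" for n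
    using cInf_lessD[of "J ` vanishing E" "m + 1 / real (Suc n)"] z unfolding m_def by auto
  then obtain u where u: "\<And>n. u n \<in> vanishing E" "\<And>n. J (u n) < m + 1 / real (Suc n)" by metis
  define e where "e n = 2 * (1 / real (Suc n))" for n
  have e: "e \<longlonglongrightarrow> 0"
    unfolding e_def using tendsto_mult_left[OF lim_1_over_n[THEN LIMSEQ_Suc], of 2] by simp
  have "energy S (\<lambda>x. u n x - u k x) (\<lambda>x. u n x - u k x) \<le> e n + e k" for n k
  proof -
    let ?d = "\<lambda>x. u n x - u k x"
    have d: "?d \<in> vanishing E" by (rule vanishing_diff[OF u(1) u(1)])
    \<comment> \<open>Comparing \<open>J\<close> at the two ends of the segment with its value at the midpoint, which is at
      least \<open>m\<close>, is the parallelogram law.\<close>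
    have "J (\<lambda>x. u k x + 1 * ?d x) = J (u n)" by simp
    then have "J (u n) = J (u k) + 2 * (energy S (u k) ?d - L ?d) + energy S ?d ?d"
      using J_expand[OF u(1)[of k] d, of 1] by simp
    moreover have "m \<le> J (u k) + (energy S (u k) ?d - L ?d) + energy S ?d ?d / 4"
      using m_le[OF vanishing_comb[OF u(1)[of k] d, of "1/2"]] J_expand[OF u(1)[of k] d, of "1/2"]
      by (simp add: power2_eq_square)
    ultimately have "energy S ?d ?d \<le> 2 * (J (u n) - m) + 2 * (J (u k) - m)" by argo
    also have "\<dots> \<le> e n + e k" using u(2)[of n] u(2)[of k] by (simp add: e_def)
    finally show ?thesis .
  qed
  then obtain h where h: "h \<in> vanishing E"
    "\<And>n. energy S (\<lambda>x. u n x - h x) (\<lambda>x. u n x - h x) \<le> e n"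
    using vanishing_complete[where u=u and e=e, OF E u(1) _ e] by metis
  have "energy S h v = L v" if v: "v \<in> vanishing E" for v
  proof -
    note dom = vanishingD(1)[OF h(1)] vanishingD(1)[OF u(1)] vanishingD(1)[OF v]
    have lim: "(\<lambda>n. energy S (u n) v) \<longlonglongrightarrow> energy S h v"
    proof (rule LIM_zero_cancel, rule Lim_null_comparison)
      show "\<forall>\<^sub>F n in sequentially. norm (energy S (u n) v - energy S h v) \<le> sqrt (e n) * sqrt (energy S v v)"
      proof (rule always_eventually, rule allI)
        fix n
        have "\<bar>energy S (u n) v - energy S h v\<bar> = \<bar>energy S (\<lambda>x. u n x - h x) v\<bar>"
          using dom by (simp add: energy_diff)
        also have "\<dots> \<le> sqrt (energy S (\<lambda>x. u n x - h x) (\<lambda>x. u n x - h x)) * sqrt (energy S v v)"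
          by (intro energy_Cauchy_Schwarz dom_energy_diff dom)
        also have "\<dots> \<le> sqrt (e n) * sqrt (energy S v v)"
          by (intro mult_right_mono real_sqrt_le_mono h real_sqrt_ge_zero energy_nonneg dom)
        finally show "norm (energy S (u n) v - energy S h v) \<le> sqrt (e n) * sqrt (energy S v v)"
          by simp
      qed
      show "(\<lambda>n. sqrt (e n) * sqrt (energy S v v)) \<longlonglongrightarrow> 0"
        using tendsto_mult_right[OF tendsto_real_sqrt[OF e], of "sqrt (energy S v v)"] by simp
    qed
    \<comment> \<open>Minimality is used along the minimising sequence, where \<open>J\<close> exceeds \<open>m\<close> by a null sequence.\<close>
    have "0 \<le> 0 + 2 * t * (energy S h v - L v) + t\<^sup>2 * energy S v v" for t
    proof -
      have "(\<lambda>n. 1 / real (Suc n) + 2 * t * (energy S (u n) v - L v) + t\<^sup>2 * energy S v v)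
        \<longlonglongrightarrow> 0 + 2 * t * (energy S h v - L v) + t\<^sup>2 * energy S v v"
        by (intro tendsto_intros lim lim_1_over_n[THEN LIMSEQ_Suc])
      then show ?thesis
      proof (rule LIMSEQ_le_const, intro exI allI impI)
        fix n
        show "0 \<le> 1 / real (Suc n) + 2 * t * (energy S (u n) v - L v) + t\<^sup>2 * energy S v v"
          using m_le[OF vanishing_comb[OF u(1)[of n] v, of t]] J_expand[OF u(1)[of n] v, of t] u(2)[of n]
          by linarith
      qed
    qed
    then have "(energy S h v - L v)\<^sup>2 \<le> 0 * energy S v v"
      by (rule nonneg_quadratic_discriminant)
    then show ?thesis by simp
  qed
  then show ?thesis using that h(1) by blast
qed

end

section \<open>The resistance radius\<close>

context nontrivial_harmonic_structure
begin

definition resistance_center :: "real \<Rightarrow> 'a \<Rightarrow> bool" where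
  "resistance_center R x0 \<longleftrightarrow> x0 \<in> attractor S \<and>
     (\<forall>x\<in>attractor S. \<forall>u\<in>dom_energy S. \<bar>u x - u x0\<bar>\<^sup>2 \<le> R * energy S u u)"

text \<open>Some function of finite energy takes different values at the center and at another point.\<close>

lemma resistance_center_nonneg:
  assumes "resistance_center R x0"
  shows "0 \<le> R"
proof -
  have x0: "x0 \<in> attractor S" using assms by (simp add: resistance_center_def)
  obtain x where x: "x \<in> attractor S" "x \<noteq> x0" using nontrivial by metis
  obtain u where u: "u \<in> dom_energy S" "u x = 1" "u x0 = 0"
    using dom_energy_separates[of x "{x0}"] x x0 by auto
  have "\<bar>u x - u x0\<bar>\<^sup>2 \<le> R * energy S u u"
    using assms x u unfolding resistance_center_def by blast
  then have "1 \<le> R * energy S u u" using u by simp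
  then show ?thesis using energy_nonneg[OF u(1)] by (smt (verit) mult_neg_pos mult_nonpos_nonneg)
qed

text \<open>The infimum of the admissible radii is admissible: centers for a minimising sequence of radii
  accumulate by compactness, and finite energy functions are continuous.\<close>

lemma resistance_radius_center: "\<exists>x0. resistance_center (resistance_radius S) x0"
proof -
  let ?A = "{R. \<exists>x0. resistance_center R x0}"
  obtain C where C: "0 \<le> C"
    "\<And>u x y. \<lbrakk>u \<in> dom_energy S; x \<in> attractor S; y \<in> attractor S\<rbrakk>
      \<Longrightarrow> \<bar>u x - u y\<bar> \<le> C * sqrt (energy S u u)"
    using resistance_bounded by metis
  obtain p where p: "p \<in> attractor S" using attractor_nonempty by auto
  have "resistance_center (C\<^sup>2) p"
    unfolding resistance_center_def
  proof (intro conjI ballI p)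
    fix x u assume "x \<in> attractor S" "u \<in> dom_energy S"
    then have "\<bar>u x - u p\<bar>\<^sup>2 \<le> (C * sqrt (energy S u u))\<^sup>2" using C(2) p by (intro power_mono) auto
    then show "\<bar>u x - u p\<bar>\<^sup>2 \<le> C\<^sup>2 * energy S u u"
      using energy_nonneg \<open>u \<in> dom_energy S\<close> by (simp add: power_mult_distrib)
  qed
  then have ne: "?A \<noteq> {}" by blast
  have bdd: "bdd_below ?A" using resistance_center_nonneg by (auto intro!: bdd_belowI)
  define m where "m = Inf ?A"
  have "\<exists>R x0. resistance_center R x0 \<and> R < m + 1 / real (Suc n)" for n
    using cInf_lessD[OF ne, of "m + 1 / real (Suc n)"] unfolding m_def by auto
  then obtain R X where RX: "\<And>n. resistance_center (R n) (X n)" "\<And>n. R n < m + 1 / real (Suc n)"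
    by metis
  have X: "X n \<in> attractor S" for n using RX(1) by (simp add: resistance_center_def)
  obtain l r where l: "l \<in> attractor S" "strict_mono r" "(X \<circ> r) \<longlonglongrightarrow> l"
    using attractor_compact[unfolded compact_def] X by metis
  have "resistance_center m l"
    unfolding resistance_center_def
  proof (intro conjI ballI l(1))
    fix x u assume x: "x \<in> attractor S" and u: "u \<in> dom_energy S"
    have uX: "(\<lambda>n. u ((X \<circ> r) n)) \<longlonglongrightarrow> u l"
      by (rule continuous_on_tendsto_compose[OF dom_energy_continuous[OF u] l(3,1)]) (simp add: X)
    have inv: "(\<lambda>n. 1 / real (Suc (r n))) \<longlonglongrightarrow> 0"
      using LIMSEQ_subseq_LIMSEQ[OF lim_1_over_n[where 'a=real, THEN LIMSEQ_Suc] l(2)]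
      by (simp add: o_def)
    show "\<bar>u x - u l\<bar>\<^sup>2 \<le> m * energy S u u"
    proof (rule LIMSEQ_le)
      show "(\<lambda>n. \<bar>u x - u ((X \<circ> r) n)\<bar>\<^sup>2) \<longlonglongrightarrow> \<bar>u x - u l\<bar>\<^sup>2" by (intro tendsto_intros uX)
      show "(\<lambda>n. (m + 1 / real (Suc (r n))) * energy S u u) \<longlonglongrightarrow> m * energy S u u"
        using tendsto_mult_right[OF tendsto_add[OF tendsto_const inv], of m "energy S u u"] by simp
      show "\<exists>N. \<forall>n\<ge>N. \<bar>u x - u ((X \<circ> r) n)\<bar>\<^sup>2 \<le> (m + 1 / real (Suc (r n))) * energy S u u"
      proof (intro exI allI impI)
        fix n
        have "\<bar>u x - u (X (r n))\<bar>\<^sup>2 \<le> R (r n) * energy S u u"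
          using RX(1) x u unfolding resistance_center_def by blast
        also have "\<dots> \<le> (m + 1 / real (Suc (r n))) * energy S u u"
          by (rule mult_right_mono[OF less_imp_le[OF RX(2)] energy_nonneg[OF u]])
        finally show "\<bar>u x - u ((X \<circ> r) n)\<bar>\<^sup>2 \<le> (m + 1 / real (Suc (r n))) * energy S u u" by simp
      qed
    qed
  qed
  moreover have "resistance_radius S = (LEAST R. \<exists>x0. resistance_center R x0)"
    unfolding resistance_radius_def resistance_center_def by (simp only: Bex_def)
  moreover have "(LEAST R. \<exists>x0. resistance_center R x0) = m"
    by (rule Least_equality) (use \<open>resistance_center m l\<close> cInf_lower[OF _ bdd] in \<open>auto simp: m_def\<close>)
  ultimately show ?thesis by metis
qed

section \<open>Splines\<close>

text \<open>A function minus the Riesz representer of its energy functional on functions vanishing on the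
  nodes is a spline with the same nodal values.\<close>

lemma spline_interpolant:
  assumes E: "E \<noteq> {}" "E \<subseteq> attractor S" and u: "u \<in> dom_energy S"
  obtains s where "s \<in> harmonic_splines S E" "\<And>x. x \<in> E \<Longrightarrow> s x = u x"
proof -
  obtain h where h: "h \<in> vanishing E" "\<And>v. v \<in> vanishing E \<Longrightarrow> energy S h v = energy S u v"
  proof (rule energy_riesz[OF E, where L="energy S u" and c="sqrt (energy S u u)"])
    fix v z t assume "v \<in> vanishing E" "z \<in> vanishing E"
    then show "energy S u (\<lambda>x. v x + t * z x) = energy S u v + t * energy S u z"
      using energy_comb[of v z u t] u vanishingD(1) by (simp add: energy_commute[of u])
  qed (use u vanishingD(1) energy_Cauchy_Schwarz in auto)
  have "(\<lambda>x. u x - h x) \<in> harmonic_splines S E"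
    unfolding harmonic_splines_def
    using u h vanishingD(1)[OF h(1)] dom_energy_diff energy_diff by (auto simp: vanishing_def)
  then show ?thesis using that vanishingD(2)[OF h(1)] by simp
qed

lemma spline_dom: "s \<in> harmonic_splines S E \<Longrightarrow> s \<in> dom_energy S"
  by (simp add: harmonic_splines_def)

lemma spline_orthogonal:
  "s \<in> harmonic_splines S E \<Longrightarrow> v \<in> vanishing E \<Longrightarrow> energy S s v = 0"
  by (simp add: harmonic_splines_def vanishing_def)

text \<open>Separation of points provides a function of finite energy with the prescribed nodal values, and
  its interpolant is the required spline.\<close>

lemma spline_basis:
  assumes E: "finite E" "E \<subseteq> attractor S" and x: "x \<in> E"
  shows "spline_basis S E x \<in> harmonic_splines S E" "spline_basis S E x x = 1"
    "\<And>y. y \<in> E \<Longrightarrow> y \<noteq> x \<Longrightarrow> spline_basis S E x y = 0"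
proof -
  obtain u where u: "u \<in> dom_energy S" "u x = 1" "\<And>y. y \<in> E - {x} \<Longrightarrow> u y = 0"
    using dom_energy_separates[of x "E - {x}"] E x by blast
  obtain s where s: "s \<in> harmonic_splines S E" "\<And>y. y \<in> E \<Longrightarrow> s y = u y"
    using spline_interpolant[of E u] E u x by auto
  have "\<exists>v. v \<in> harmonic_splines S E \<and> v x = 1 \<and> (\<forall>y\<in>E - {x}. v y = 0)"
    using s u x by (intro exI[of _ s]) auto
  from someI_ex[OF this, folded spline_basis_def]
  show "spline_basis S E x \<in> harmonic_splines S E" "spline_basis S E x x = 1"
    "\<And>y. y \<in> E \<Longrightarrow> y \<noteq> x \<Longrightarrow> spline_basis S E x y = 0" by auto
qed

definition interpolate :: "'a set \<Rightarrow> ('a \<Rightarrow> real) \<Rightarrow> 'a \<Rightarrow> real" where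
  "interpolate E u y = (\<Sum>x\<in>E. u x * spline_basis S E x y)"

lemma interpolate_spline:
  assumes "finite E" "E \<subseteq> attractor S"
  shows "interpolate E u \<in> harmonic_splines S E"
proof -
  have d: "spline_basis S E x \<in> dom_energy S" if "x \<in> E" for x
    using spline_dom[OF spline_basis(1)[OF assms that]] .
  have "interpolate E u \<in> dom_energy S"
    unfolding interpolate_def[abs_def] by (rule dom_energy_sum[OF assms(1) d])
  moreover have "energy S (interpolate E u) v = 0" if "v \<in> vanishing E" for v
    unfolding interpolate_def[abs_def]
    using energy_sum[OF assms(1) d vanishingD(1)[OF that]]
      spline_orthogonal[OF spline_basis(1)[OF assms] that] by simp
  ultimately show ?thesis by (simp add: harmonic_splines_def vanishing_def)
qed

lemma interpolate_nodes:
  assumes "finite E" "E \<subseteq> attractor S" "y \<in> E"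
  shows "interpolate E u y = u y"
proof -
  have "interpolate E u y = (\<Sum>x\<in>E. if x = y then u y else 0)"
    unfolding interpolate_def
    by (intro sum.cong refl) (use spline_basis[OF assms(1,2)] assms(3) in auto)
  then show ?thesis using assms by simp
qed

lemma interpolation_error_vanishing:
  assumes "finite E" "E \<subseteq> attractor S" "u \<in> dom_energy S"
  shows "(\<lambda>x. u x - interpolate E u x) \<in> vanishing E"
  using assms interpolate_nodes[OF assms(1,2)] spline_dom[OF interpolate_spline[OF assms(1,2)]]
  by (simp add: vanishing_def dom_energy_diff)

text \<open>Interpolation is the energy orthogonal projection onto splines.\<close>

lemma interpolation_error_energy:
  assumes "finite E" "E \<subseteq> attractor S" "u \<in> dom_energy S"
  shows "energy S (\<lambda>x. u x - interpolate E u x) (\<lambda>x. u x - interpolate E u x) \<le> energy S u u"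
proof -
  let ?s = "interpolate E u" and ?d = "\<lambda>x. u x - interpolate E u x"
  have s: "?s \<in> dom_energy S" by (rule spline_dom[OF interpolate_spline[OF assms(1,2)]])
  have d: "?d \<in> vanishing E" by (rule interpolation_error_vanishing[OF assms])
  have "energy S u u = energy S (\<lambda>x. ?s x + 1 * ?d x) (\<lambda>x. ?s x + 1 * ?d x)" by simp
  also have "\<dots> = energy S ?s ?s + energy S ?d ?d"
    using energy_expand[OF s vanishingD(1)[OF d], of 1]
      spline_orthogonal[OF interpolate_spline[OF assms(1,2)] d] by simp
  finally show ?thesis using energy_nonneg[OF s] by simp
qed

text \<open>Constants have energy zero and are therefore reproduced by the interpolation.\<close>

lemma interpolate_const:
  assumes "finite E" "E \<noteq> {}" "E \<subseteq> attractor S" "y \<in> attractor S"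
  shows "(\<Sum>x\<in>E. spline_basis S E x y) = 1"
proof -
  let ?d = "\<lambda>x. 1 - interpolate E (\<lambda>_. 1) x"
  have s: "interpolate E (\<lambda>_. 1) \<in> harmonic_splines S E" by (rule interpolate_spline[OF assms(1,3)])
  have d: "?d \<in> vanishing E"
    using interpolation_error_vanishing[OF assms(1,3) dom_energy_const] .
  have "energy S ?d ?d \<le> 0"
    using interpolation_error_energy[OF assms(1,3) dom_energy_const, of 1]
    by (simp add: energy_const)
  then have "?d y = 0" by (rule vanishing_energy_zero[OF assms(2,3) d _ assms(4)])
  then show ?thesis by (simp add: interpolate_def)
qed

end

section \<open>The Green's function\<close>

locale measured_harmonic_structure = nontrivial_harmonic_structure S + fractal_measure S M
  for S :: "('i::finite, 'a::euclidean_space) fractal" and M :: "'a measure"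
begin

lemma space_M: "space M = attractor S"
  using sets_eq_imp_space_eq[OF sets_M] by (simp add: space_restrict_space)

lemma measurable_continuous:
  fixes u :: "'a \<Rightarrow> real"
  shows "continuous_on (attractor S) u \<Longrightarrow> u \<in> borel_measurable M"
  using borel_measurable_continuous_on_restrict measurable_cong_sets[OF sets_M refl] by blast

lemma integrable_continuous_mult:
  fixes v f :: "'a \<Rightarrow> real"
  assumes v: "continuous_on (attractor S) v" and f: "integrable M f"
  shows "integrable M (\<lambda>x. v x * f x)"
proof -
  obtain B where B: "\<And>x. x \<in> attractor S \<Longrightarrow> \<bar>v x\<bar> \<le> B"
    using compact_imp_bounded[OF compact_continuous_image[OF v attractor_compact]]
    by (auto simp: bounded_iff)
  show ?thesis
  proof (rule Bochner_Integration.integrable_bound)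
    show "integrable M (\<lambda>x. B * f x)" using f by simp
    show "(\<lambda>x. v x * f x) \<in> borel_measurable M"
      using measurable_continuous[OF v] f by simp
    show "AE x in M. norm (v x * f x) \<le> norm (B * f x)"
    proof (rule AE_I2)
      fix x assume "x \<in> space M"
      then have "\<bar>v x\<bar> \<le> \<bar>B\<bar>" using B[of x] space_M by simp
      then show "norm (v x * f x) \<le> norm (B * f x)" by (simp add: abs_mult mult_right_mono)
    qed
  qed
qed

lemma integrable_continuous:
  fixes u :: "'a \<Rightarrow> real"
  shows "continuous_on (attractor S) u \<Longrightarrow> integrable M u"
  using integrable_continuous_mult[of u "\<lambda>_. 1"] by simp

lemma integrable_dom: "u \<in> dom_energy S \<Longrightarrow> integrable M u"
  by (rule integrable_continuous[OF dom_energy_continuous])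

lemma integrable_dom_mult:
  "v \<in> dom_energy S \<Longrightarrow> integrable M f \<Longrightarrow> integrable M (\<lambda>x. v x * f x)"
  by (rule integrable_continuous_mult[OF dom_energy_continuous])

text \<open>Functions vanishing on \<open>E\<close> are uniformly bounded by their energy, so integration against an
  \<open>L\<^sup>1\<close> function is a bounded functional.\<close>

lemma dirichlet_solution_exists:
  assumes E: "E \<noteq> {}" "E \<subseteq> attractor S" and f: "integrable M f"
  obtains h where "dirichlet_solution S M E f h"
proof -
  obtain C where C: "0 \<le> C"
    "\<And>u x. \<lbrakk>u \<in> vanishing E; x \<in> attractor S\<rbrakk> \<Longrightarrow> \<bar>u x\<bar> \<le> C * sqrt (energy S u u)"
    using vanishing_bounded[OF E] by metis
  obtain h where h: "h \<in> vanishing E" "\<And>v. v \<in> vanishing E \<Longrightarrow> energy S h v = (\<integral>x. v x * f x \<partial>M)"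
  proof (rule energy_riesz[OF E, where L="\<lambda>v. \<integral>x. v x * f x \<partial>M" and c="C * (\<integral>x. \<bar>f x\<bar> \<partial>M)"])
    fix u v t assume "u \<in> vanishing E" "v \<in> vanishing E"
    then have "integrable M (\<lambda>x. u x * f x)" "integrable M (\<lambda>x. v x * f x)"
      using integrable_dom_mult f vanishingD(1) by auto
    then show "(\<integral>x. (u x + t * v x) * f x \<partial>M) = (\<integral>x. u x * f x \<partial>M) + t * (\<integral>x. v x * f x \<partial>M)"
      by (simp add: distrib_right mult.assoc)
  next
    fix v assume v: "v \<in> vanishing E"
    let ?b = "C * sqrt (energy S v v)"
    have "\<bar>\<integral>x. v x * f x \<partial>M\<bar> \<le> (\<integral>x. \<bar>v x * f x\<bar> \<partial>M)" by (rule integral_abs_bound)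
    also have "\<dots> \<le> (\<integral>x. ?b * \<bar>f x\<bar> \<partial>M)"
      using integrable_abs[OF integrable_dom_mult[OF vanishingD(1)[OF v] f], unfolded abs_mult] f C(2)[OF v]
      by (intro integral_mono) (auto simp: abs_mult space_M intro!: mult_right_mono)
    finally show "\<bar>\<integral>x. v x * f x \<partial>M\<bar> \<le> C * (\<integral>x. \<bar>f x\<bar> \<partial>M) * sqrt (energy S v v)"
      by (simp add: mult_ac)
  qed blast
  have "dirichlet_solution S M E f h"
    using h by (auto simp: dirichlet_solution_def vanishing_def mult.commute[of "f _"])
  then show ?thesis using that by blast
qed

text \<open>The Green's function is the reproducing kernel of the energy on functions that vanish on
  \<open>E\<close>.  Its symmetry is that of the energy, its joint continuity is the uniform
  equicontinuity of functions of bounded energy, and the reproducing property turns a weak solution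
  into its integral representation.\<close>

lemma greens_function_exists:
  assumes E: "E \<noteq> {}" "E \<subseteq> attractor S"
  shows "\<exists>G. is_greens_function S M E G"
proof -
  obtain C where C: "0 \<le> C"
    "\<And>u x. \<lbrakk>u \<in> vanishing E; x \<in> attractor S\<rbrakk> \<Longrightarrow> \<bar>u x\<bar> \<le> C * sqrt (energy S u u)"
    using vanishing_bounded[OF E] by metis
  have "\<exists>h. h \<in> vanishing E \<and> (\<forall>v\<in>vanishing E. energy S h v = v x)" if x: "x \<in> attractor S" for x
  proof -
    obtain h where "h \<in> vanishing E" "\<And>v. v \<in> vanishing E \<Longrightarrow> energy S h v = v x"
      by (rule energy_riesz[OF E, where L="\<lambda>v. v x" and c=C]) (use C(2) x in auto)
    then show ?thesis by blast
  qed
  then obtain G where G: "\<And>x. x \<in> attractor S \<Longrightarrow> G x \<in> vanishing E"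
    "\<And>x v. x \<in> attractor S \<Longrightarrow> v \<in> vanishing E \<Longrightarrow> energy S (G x) v = v x"
    by metis
  have sym: "G x y = G y x" if "x \<in> attractor S" "y \<in> attractor S" for x y
    using G(2)[OF that(1) G(1)[OF that(2)]] G(2)[OF that(2) G(1)[OF that(1)]]
    by (simp add: energy_commute)
  \<comment> \<open>\<open>\<E>(G\<^sub>x, G\<^sub>x) = G\<^sub>x(x) \<le> C \<E>(G\<^sub>x, G\<^sub>x)\<^sup>1\<^sup>/\<^sup>2\<close> bounds the energy of all sections at once.\<close>
  have bound: "sqrt (energy S (G x) (G x)) \<le> C" if x: "x \<in> attractor S" for x
  proof -
    let ?s = "sqrt (energy S (G x) (G x))"
    have e: "energy S (G x) (G x) = G x x" by (rule G(2)[OF x G(1)[OF x]])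
    have "0 \<le> energy S (G x) (G x)" using energy_nonneg G(1)[OF x] vanishingD(1) by blast
    then have "?s * ?s = G x x" "0 \<le> ?s" using e by simp_all
    moreover have "G x x \<le> C * ?s" using C(2)[OF G(1)[OF x] x] by simp
    ultimately show ?thesis using C(1)
      by (metis mult_le_cancel_right not_le order_le_less)
  qed
  have cont: "continuous_on (attractor S \<times> attractor S) (\<lambda>(x, y). G x y)"
    unfolding continuous_on_iff
  proof (intro ballI allI impI)
    fix z and r :: real assume z: "z \<in> attractor S \<times> attractor S" and "0 < r"
    obtain x y where xy: "z = (x, y)" "x \<in> attractor S" "y \<in> attractor S" using z by auto
    define e where "e = r / (2 * C + 1)"
    have e: "0 < e" "2 * (e * C) < r" using \<open>0 < r\<close> C(1) by (auto simp: e_def field_simps)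
    obtain d where d: "0 < d"
      "\<And>u x y. \<lbrakk>u \<in> dom_energy S; x \<in> attractor S; y \<in> attractor S; dist x y < d\<rbrakk>
        \<Longrightarrow> \<bar>u x - u y\<bar> \<le> e * sqrt (energy S u u)"
      using dom_energy_equicontinuous[OF e(1)] by metis
    have osc: "\<bar>G a b - G a c\<bar> \<le> e * C"
      if "a \<in> attractor S" "b \<in> attractor S" "c \<in> attractor S" "dist b c < d" for a b c
      using d(2)[OF vanishingD(1)[OF G(1)[OF that(1)]] that(2-4)]
        mult_left_mono[OF bound[OF that(1)], of e] e(1) by linarith
    show "\<exists>d>0. \<forall>z'\<in>attractor S \<times> attractor S. dist z' z < d \<longrightarrow>
      dist (case z' of (x, y) \<Rightarrow> G x y) (case z of (x, y) \<Rightarrow> G x y) < r"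
    proof (intro exI[of _ d] conjI d(1) ballI impI)
      fix z' assume z': "z' \<in> attractor S \<times> attractor S" "dist z' z < d"
      obtain x' y' where xy': "z' = (x', y')" "x' \<in> attractor S" "y' \<in> attractor S" using z' by auto
      have "dist x' x < d" "dist y' y < d"
        using z'(2) dist_fst_le[of z' z] dist_snd_le[of z' z] xy xy' by auto
      then have "\<bar>G x' y' - G x' y\<bar> \<le> e * C" "\<bar>G y x' - G y x\<bar> \<le> e * C"
        using osc xy xy' by auto
      then have "\<bar>G x' y' - G x y\<bar> < r"
        using e(2) sym[OF xy'(2) xy(3)] sym[OF xy(2,3)] by linarith
      then show "dist (case z' of (x, y) \<Rightarrow> G x y) (case z of (x, y) \<Rightarrow> G x y) < r"
        using xy xy' by (simp add: dist_real_def)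
    qed
  qed
  have rep: "h x = (\<integral>y. G x y * f y \<partial>M)"
    if h: "dirichlet_solution S M E f h" and x: "x \<in> attractor S" for f h x
  proof -
    have "h \<in> vanishing E" using h by (simp add: dirichlet_solution_def vanishing_def)
    then have "h x = energy S h (G x)" using G(2)[OF x] by (simp add: energy_commute)
    also have "\<dots> = (\<integral>y. f y * G x y \<partial>M)"
      using h G(1)[OF x] by (simp add: dirichlet_solution_def vanishing_def)
    finally show ?thesis by (simp add: mult.commute)
  qed
  have conv: "dirichlet_solution S M E f h"
    if f: "integrable M f" and h: "\<forall>x\<in>attractor S. h x = (\<integral>y. G x y * f y \<partial>M)" for f h
  proof -
    obtain h0 where h0: "dirichlet_solution S M E f h0" using dirichlet_solution_exists[OF E f] by blast
    have eq: "h x = h0 x" if "x \<in> attractor S" for x using h rep[OF h0] that by simp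
    have "energy S h v = energy S h0 v" for v by (rule energy_cong) (use eq in auto)
    moreover have "h \<in> dom_energy S \<longleftrightarrow> h0 \<in> dom_energy S" by (rule dom_energy_cong) (use eq in auto)
    moreover have "h x = h0 x" if "x \<in> E" for x using eq that E(2) by blast
    ultimately show ?thesis using h0 by (simp add: dirichlet_solution_def)
  qed
  have "is_greens_function S M E G"
    unfolding is_greens_function_def using cont sym rep conv by blast
  then show ?thesis by blast
qed

lemma green_integral_solution:
  assumes E: "E \<noteq> {}" "E \<subseteq> attractor S"
  shows "dirichlet_solution S M E (\<lambda>_. 1) (green_integral S M E)"
proof -
  have "is_greens_function S M E (greens_function S M E)"
    unfolding greens_function_def by (rule someI_ex[OF greens_function_exists[OF E]])
  moreover have "integrable M (\<lambda>_. 1 :: real)" by simp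
  ultimately have "dirichlet_solution S M E (\<lambda>_. 1) (green_integral S M E) \<longleftrightarrow>
    (\<forall>x\<in>attractor S. green_integral S M E x = (\<integral>y. greens_function S M E x y * 1 \<partial>M))"
    unfolding is_greens_function_def by blast
  then show ?thesis by (simp add: green_integral_def)
qed

lemma green_integral_vanishing:
  assumes E: "E \<noteq> {}" "E \<subseteq> attractor S"
  shows "green_integral S M E \<in> vanishing E"
  using green_integral_solution[OF E] by (simp add: dirichlet_solution_def vanishing_def)

lemma energy_green_integral:
  assumes E: "E \<noteq> {}" "E \<subseteq> attractor S" and v: "v \<in> vanishing E"
  shows "energy S (green_integral S M E) v = (\<integral>x. v x \<partial>M)"
  using green_integral_solution[OF E] v by (simp add: dirichlet_solution_def vanishing_def)

text \<open>The unique minimiser \<open>g\<close> of \<open>\<E>(v, v) - 2 \<integral>v\<close> among the \<open>v\<close> vanishing on \<open>E\<close> coincides with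
  \<open>\<bar>g\<bar>\<close>, because passing to the absolute value does not increase this functional.\<close>

lemma green_integral_nonneg:
  assumes E: "E \<noteq> {}" "E \<subseteq> attractor S" and x: "x \<in> attractor S"
  shows "0 \<le> green_integral S M E x"
proof -
  define g where "g = green_integral S M E"
  define a where "a = (\<lambda>x. \<bar>g x\<bar>)"
  have g: "g \<in> vanishing E" unfolding g_def by (rule green_integral_vanishing[OF E])
  have a: "a \<in> vanishing E"
    using g abs_dom_energy(1) by (auto simp: vanishing_def a_def)
  have ea: "energy S a a \<le> energy S g g"
    unfolding a_def by (rule abs_dom_energy(2)[OF vanishingD(1)[OF g]])
  note dom = vanishingD(1)[OF g] vanishingD(1)[OF a]
  have "(\<integral>x. g x \<partial>M) \<le> (\<integral>x. a x \<partial>M)"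
    by (intro integral_mono integrable_dom dom) (simp add: a_def)
  then have le: "energy S g g \<le> energy S g a"
    using energy_green_integral[OF E, folded g_def] g a by simp
  have "energy S (\<lambda>x. a x + (-1) * g x) (\<lambda>x. a x + (-1) * g x) = energy S a a - 2 * energy S g a + energy S g g"
    using energy_expand[OF dom(2,1), of "-1"] by (simp add: energy_commute)
  then have "energy S (\<lambda>x. a x - g x) (\<lambda>x. a x - g x) \<le> 0" using ea le by simp
  then have "a x - g x = 0"
    by (rule vanishing_energy_zero[OF E vanishing_diff[OF a g] _ x])
  then show ?thesis unfolding a_def g_def[symmetric] by simp
qed

lemma green_integral_le_delta1:
  assumes E: "E \<noteq> {}" "E \<subseteq> attractor S" and x: "x \<in> attractor S"
  shows "green_integral S M E x \<le> delta1 S M E"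
  unfolding delta1_def
proof (rule cSUP_upper[OF x])
  have "continuous_on (attractor S) (green_integral S M E)"
    by (intro dom_energy_continuous vanishingD(1)[OF green_integral_vanishing[OF E]])
  then show "bdd_above (green_integral S M E ` attractor S)"
    by (intro bounded_imp_bdd_above compact_imp_bounded compact_continuous_image attractor_compact)
qed

lemma delta0_eq:
  assumes E: "E \<noteq> {}" "E \<subseteq> attractor S"
  shows "delta0 S M E = sqrt (energy S (green_integral S M E) (green_integral S M E))"
  using energy_green_integral[OF E green_integral_vanishing[OF E]] by (simp add: delta0_def)

section \<open>Quadrature\<close>

text \<open>This is the Cauchy-Schwarz inequality for \<open>\<E>(g\<^sub>E, v) = \<integral>v\<close>, since
  \<open>\<delta>\<^sub>0\<^sup>2 = \<integral>g\<^sub>E = \<E>(g\<^sub>E, g\<^sub>E)\<close>.\<close>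

lemma integral_vanishing_le_delta0:
  assumes E: "E \<noteq> {}" "E \<subseteq> attractor S" and v: "v \<in> vanishing E"
  shows "\<bar>\<integral>x. v x \<partial>M\<bar> \<le> delta0 S M E * sqrt (energy S v v)"
  using energy_Cauchy_Schwarz[OF vanishingD(1)[OF green_integral_vanishing[OF E]] vanishingD(1)[OF v]]
  by (simp add: delta0_eq[OF E] energy_green_integral[OF E v])

lemma integral_interpolate:
  assumes E: "finite E" "E \<subseteq> attractor S"
  shows "(\<integral>x. interpolate E u x \<partial>M) = (\<Sum>x\<in>E. natural_weight S M E x * u x)"
proof -
  have "integrable M (spline_basis S E x)" if "x \<in> E" for x
    by (rule integrable_dom[OF spline_dom[OF spline_basis(1)[OF E that]]])
  then show ?thesis by (simp add: interpolate_def natural_weight_def mult.commute)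
qed

lemma sum_natural_weight:
  assumes E: "finite E" "E \<noteq> {}" "E \<subseteq> attractor S"
  shows "(\<Sum>x\<in>E. natural_weight S M E x) = 1"
proof -
  have "(\<integral>x. interpolate E (\<lambda>_. 1) x \<partial>M) = (\<integral>x. 1 \<partial>M)"
    by (rule Bochner_Integration.integral_cong)
      (use interpolate_const[OF E] in \<open>auto simp: interpolate_def space_M\<close>)
  then show ?thesis using integral_interpolate[OF E(1,3), of "\<lambda>_. 1"] by (simp add: prob_space)
qed

text \<open>Both weight systems have total mass one, so the value at the resistance center may be
  subtracted from \<open>u\<close>.\<close>

lemma weight_change:
  assumes E: "finite E" "E \<noteq> {}" "E \<subseteq> attractor S" and w: "(\<Sum>x\<in>E. w x) = 1"
    and u: "u \<in> dom_energy S"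
  shows "\<bar>(\<Sum>x\<in>E. (natural_weight S M E x - w x) * u x)\<bar> \<le> weight_defect S M E w * sqrt (energy S u u)"
proof -
  let ?p = "natural_weight S M E" and ?R = "resistance_radius S"
  obtain x0 where x0: "resistance_center ?R x0" using resistance_radius_center by blast
  have "(\<Sum>x\<in>E. (?p x - w x) * u x) = (\<Sum>x\<in>E. (?p x - w x) * (u x - u x0))"
    using sum_natural_weight[OF E] w
    by (simp add: right_diff_distrib sum_subtractf flip: sum_distrib_right)
  also have "\<bar>\<dots>\<bar> \<le> (\<Sum>x\<in>E. \<bar>(?p x - w x) * (u x - u x0)\<bar>)" by (rule sum_abs)
  also have "\<dots> \<le> (\<Sum>x\<in>E. \<bar>?p x - w x\<bar> * (sqrt ?R * sqrt (energy S u u)))"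
  proof (rule sum_mono)
    fix x assume "x \<in> E"
    then have "\<bar>u x - u x0\<bar>\<^sup>2 \<le> ?R * energy S u u"
      using x0 u E(3) unfolding resistance_center_def by blast
    then have "\<bar>u x - u x0\<bar> \<le> sqrt (?R * energy S u u)" by (rule real_le_rsqrt)
    then show "\<bar>(?p x - w x) * (u x - u x0)\<bar> \<le> \<bar>?p x - w x\<bar> * (sqrt ?R * sqrt (energy S u u))"
      unfolding abs_mult real_sqrt_mult by (intro mult_left_mono) auto
  qed
  also have "\<dots> = weight_defect S M E w * sqrt (energy S u u)"
    by (simp add: weight_defect_def sum_distrib_left sum_distrib_right mult_ac)
  finally show ?thesis .
qed

lemma quadrature_error_split:
  assumes E: "finite E" "E \<noteq> {}" "E \<subseteq> attractor S" and w: "(\<Sum>x\<in>E. w x) = 1"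
    and u: "u \<in> dom_energy S"
  shows "\<bar>(\<integral>x. u x \<partial>M) - (\<Sum>x\<in>E. w x * u x)\<bar> \<le>
    \<bar>\<integral>x. u x - interpolate E u x \<partial>M\<bar> + weight_defect S M E w * sqrt (energy S u u)"
proof -
  have "(\<integral>x. u x - interpolate E u x \<partial>M) = (\<integral>x. u x \<partial>M) - (\<integral>x. interpolate E u x \<partial>M)"
    by (intro Bochner_Integration.integral_diff integrable_dom u
        spline_dom[OF interpolate_spline[OF E(1,3)]])
  then have "(\<integral>x. u x \<partial>M) - (\<Sum>x\<in>E. w x * u x) =
      (\<integral>x. u x - interpolate E u x \<partial>M) + (\<Sum>x\<in>E. (natural_weight S M E x - w x) * u x)"
    by (simp add: integral_interpolate[OF E(1,3)] left_diff_distrib sum_subtractf)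
  then show ?thesis using weight_change[OF E w u] by linarith
qed

text \<open>Splines are energy orthogonal to \<open>g\<^sub>E\<close>, so the integral of the interpolation error is
  \<open>\<E>(g\<^sub>E, u)\<close>; and \<open>g\<^sub>E\<close> is a test function for the weak Laplacian, as it vanishes on \<open>E\<close>.\<close>

lemma interpolation_error_laplacian:
  assumes E: "finite E" "E \<noteq> {}" "E \<subseteq> attractor S" and B: "B \<subseteq> E"
    and u: "u \<in> dom_energy S" and f: "integrable M f" "is_laplacian S M B u f"
  shows "\<bar>\<integral>x. u x - interpolate E u x \<partial>M\<bar> \<le> delta1 S M E * (\<integral>x. \<bar>f x\<bar> \<partial>M)"
proof -
  let ?g = "green_integral S M E" and ?s = "interpolate E u"
  have g: "?g \<in> vanishing E" by (rule green_integral_vanishing[OF E(2,3)])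
  have s: "?s \<in> harmonic_splines S E" by (rule interpolate_spline[OF E(1,3)])
  have "(\<integral>x. u x - ?s x \<partial>M) = energy S ?g (\<lambda>x. u x - ?s x)"
    by (rule energy_green_integral[OF E(2,3) interpolation_error_vanishing[OF E(1,3) u], symmetric])
  also have "\<dots> = energy S ?g u - energy S ?g ?s"
    by (rule energy_diff_right[OF u spline_dom[OF s] vanishingD(1)[OF g]])
  also have "\<dots> = energy S u ?g"
    using spline_orthogonal[OF s g] by (simp add: energy_commute)
  also have "\<dots> = - (\<integral>x. ?g x * f x \<partial>M)"
  proof -
    have "\<forall>x\<in>B. ?g x = 0" using B vanishingD(2)[OF g] by blast
    then show ?thesis using f(2) vanishingD(1)[OF g] by (simp add: is_laplacian_def)
  qed
  finally have "\<bar>\<integral>x. u x - ?s x \<partial>M\<bar> = \<bar>\<integral>x. ?g x * f x \<partial>M\<bar>" by simp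
  also have "\<dots> \<le> (\<integral>x. \<bar>?g x * f x\<bar> \<partial>M)" by (rule integral_abs_bound)
  also have "\<dots> \<le> (\<integral>x. delta1 S M E * \<bar>f x\<bar> \<partial>M)"
    using integrable_abs[OF integrable_dom_mult[OF vanishingD(1)[OF g] f(1)], unfolded abs_mult] f(1)
      green_integral_nonneg[OF E(2,3)] green_integral_le_delta1[OF E(2,3)]
    by (intro integral_mono) (auto simp: abs_mult space_M intro!: mult_right_mono)
  finally show ?thesis by simp
qed

end

text \<open>A one-point attractor would be an atom.\<close>

lemma measured_harmonic_structureI:
  assumes "regular_harmonic_structure S" "fractal_measure S M"
  shows "measured_harmonic_structure S M"
proof -
  interpret regular_harmonic_structure S by fact
  interpret fractal_measure S M by fact
  have "\<exists>x\<in>attractor S. \<exists>y\<in>attractor S. x \<noteq> y"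
  proof (rule ccontr)
    assume "\<not> ?thesis"
    then obtain p where p: "attractor S = {p}" using attractor_nonempty by auto
    have sp: "space M = {p}"
      using sets_eq_imp_space_eq[OF sets_M] p by (simp add: space_restrict_space)
    have "0 < emeasure M (space M)" by (simp add: emeasure_space_1)
    then obtain B where B: "B \<subseteq> space M" "0 < emeasure M B" "emeasure M B < emeasure M (space M)"
      using non_atomic unfolding non_atomic_def by blast
    then have "B = {} \<or> B = space M" using sp by auto
    then show False using B by auto
  qed
  then show ?thesis by unfold_locales
qed

theorem theorem2p8:
  fixes S :: "('i::finite, 'a::euclidean_space) fractal"
    and M :: "'a measure"
    and E :: "'a set"
    and w :: "'a \<Rightarrow> real"
  assumes "regular_harmonic_structure S"
    and "fractal_measure S M"
    and "finite E" and "E \<noteq> {}" and "E \<subseteq> attractor S"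
    and "\<And>x. x \<in> E \<Longrightarrow> 0 < w x"
    and "(\<Sum>x\<in>E. w x) = 1"
  shows "(\<forall>u\<in>dom_energy S.
            \<bar>(\<integral>x. u x \<partial>M) - (\<Sum>x\<in>E. w x * u x)\<bar>
              \<le> (delta0 S M E + weight_defect S M E w) * sqrt (energy S u u))
       \<and> (\<forall>B. B = {} \<or> (B = bdry S \<and> bdry S \<subseteq> E) \<longrightarrow>
            (\<forall>u\<in>dom_laplacian_L1 S M B.
              \<bar>(\<integral>x. u x \<partial>M) - (\<Sum>x\<in>E. w x * u x)\<bar>
                \<le> delta1 S M E * (\<integral>x. \<bar>laplacian S M B u x\<bar> \<partial>M)
                   + weight_defect S M E w * sqrt (energy S u u)))"
proof -
  interpret measured_harmonic_structure S M
    by (rule measured_harmonic_structureI) fact+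
  note E = assms(3-5) and split = quadrature_error_split[OF assms(3-5,7)]
  show ?thesis
  proof (intro conjI ballI allI impI)
    fix u assume u: "u \<in> dom_energy S"
    let ?v = "\<lambda>x. u x - interpolate E u x"
    have "\<bar>\<integral>x. ?v x \<partial>M\<bar> \<le> delta0 S M E * sqrt (energy S ?v ?v)"
      by (rule integral_vanishing_le_delta0[OF E(2,3) interpolation_error_vanishing[OF E(1,3) u]])
    also have "\<dots> \<le> delta0 S M E * sqrt (energy S u u)"
      by (intro mult_left_mono real_sqrt_le_mono interpolation_error_energy[OF E(1,3) u])
        (simp add: delta0_eq[OF E(2,3)] energy_nonneg vanishingD(1)[OF green_integral_vanishing[OF E(2,3)]])
    finally show "\<bar>(\<integral>x. u x \<partial>M) - (\<Sum>x\<in>E. w x * u x)\<bar>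
        \<le> (delta0 S M E + weight_defect S M E w) * sqrt (energy S u u)"
      using split[OF u] by (simp add: distrib_right)
  next
    fix B u assume B: "B = {} \<or> (B = bdry S \<and> bdry S \<subseteq> E)" and u: "u \<in> dom_laplacian_L1 S M B"
    have dom: "u \<in> dom_energy S" using u by (simp add: dom_laplacian_L1_def)
    have "\<exists>f. integrable M f \<and> is_laplacian S M B u f" using u by (simp add: dom_laplacian_L1_def)
    from someI_ex[OF this, folded laplacian_def]
    have "\<bar>\<integral>x. u x - interpolate E u x \<partial>M\<bar> \<le> delta1 S M E * (\<integral>x. \<bar>laplacian S M B u x\<bar> \<partial>M)"
      using B by (intro interpolation_error_laplacian[OF E, of B] dom) auto
    then show "\<bar>(\<integral>x. u x \<partial>M) - (\<Sum>x\<in>E. w x * u x)\<bar>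
        \<le> delta1 S M E * (\<integral>x. \<bar>laplacian S M B u x\<bar> \<partial>M)
           + weight_defect S M E w * sqrt (energy S u u)"
      using split[OF dom] by linarith
  qed
qed

end
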